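(* Let $T$ be a finite tree, let $T^2$ be its square, and let $\Bbbk$ be a field. The following are equivalent: (a) the edge ideal $I(T^2)\subseteq S=\Bbbk[x_v : v\in V(T)]$ has a linear resolution; (b) $T$ is one of the following graphs: (i) the path $L_n$ with $2\le n\le 5$; (ii) a star graph; (iii) a (partially) whiskered star.
   Context: All graphs are finite and simple. For a graph $G$, the square $G^2$ is the graph on $V(G)$ whose edges are the pairs $\{x,y\}$ with $x\neq y$ and $\mathrm{dist}_G(x,y)\in\{1,2\}$. The edge ideal of a graph $G$ on vertex set $V$ is $I(G)=\langle x_ux_v : \{u,v\}\in E(G)\rangle\subseteq \Bbbk[x_v: v\in V]$. An ideal generated by quadrics has a linear resolution if its graded Betti numbers satisfy $\beta_{i,j}(I)=0$ for all $j\neq i+2$. $L_n$ denotes the path on $n$ vertices. A star graph is $K_{1,t}$ ($t\ge1$): one center adjacent to $t$ vertices of degree 1 and no other edges. A (partially) whiskered star is the tree with vertex set $\{x_0,x_1,\dots,x_n,y_1,\dots,y_m\}$, where $n\ge1$ and $1\le m\le n$, and edge set $\{\{x_0,x_i\}:1\le i\le n\}\cup\{\{x_i,y_i\}:1\le i\le m\}$.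
   Formalization: The tree is assumed to have at least two vertices: for the one-vertex tree, I(T^2)=0 vacuously has a linear resolution, but that tree is not in list (b). *)

theory Defs
  imports Main "HOL-Library.Poly_Mapping"
begin

definition simple_graph :: "('v \<Rightarrow> 'v \<Rightarrow> bool) \<Rightarrow> bool" where
  "simple_graph E \<longleftrightarrow> (\<forall>x y. E x y \<longrightarrow> E y x) \<and> (\<forall>x. \<not> E x x)"

definition connected_graph :: "('v \<Rightarrow> 'v \<Rightarrow> bool) \<Rightarrow> bool" where
  "connected_graph E \<longleftrightarrow> (\<forall>x y. E\<^sup>*\<^sup>* x y)"

definition has_cycle :: "('v \<Rightarrow> 'v \<Rightarrow> bool) \<Rightarrow> bool" where
  "has_cycle E \<longleftrightarrow> (\<exists>vs. length vs \<ge> 3 \<and> distinct vs \<and>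
      (\<forall>i. i + 1 < length vs \<longrightarrow> E (vs ! i) (vs ! (i + 1))) \<and> E (last vs) (hd vs))"

definition is_tree :: "('v \<Rightarrow> 'v \<Rightarrow> bool) \<Rightarrow> bool" where
  "is_tree E \<longleftrightarrow> simple_graph E \<and> connected_graph E \<and> \<not> has_cycle E"

definition graph_square :: "('v \<Rightarrow> 'v \<Rightarrow> bool) \<Rightarrow> 'v \<Rightarrow> 'v \<Rightarrow> bool" where
  "graph_square E x y \<longleftrightarrow> x \<noteq> y \<and> (E x y \<or> (\<exists>z. E x z \<and> E z y))"

definition is_path_graph :: "('v \<Rightarrow> 'v \<Rightarrow> bool) \<Rightarrow> nat \<Rightarrow> bool" where
  "is_path_graph E n \<longleftrightarrow> (\<exists>f. bij_betw f {..<n} (UNIV :: 'v set) \<and>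
      (\<forall>i<n. \<forall>j<n. E (f i) (f j) \<longleftrightarrow> (i + 1 = j \<or> j + 1 = i)))"

definition is_star_graph :: "('v \<Rightarrow> 'v \<Rightarrow> bool) \<Rightarrow> bool" where
  "is_star_graph E \<longleftrightarrow> (\<exists>c. (\<exists>v. v \<noteq> c) \<and>
      (\<forall>a b. E a b \<longleftrightarrow> ((a = c \<and> b \<noteq> c) \<or> (b = c \<and> a \<noteq> c))))"

definition is_whiskered_star :: "('v \<Rightarrow> 'v \<Rightarrow> bool) \<Rightarrow> bool" where
  "is_whiskered_star E \<longleftrightarrow> (\<exists>(n::nat) (m::nat) x y. 1 \<le> n \<and> 1 \<le> m \<and> m \<le> n \<and>
      inj_on x {0..n} \<and> inj_on y {1..m} \<and> x ` {0..n} \<inter> y ` {1..m} = {} \<and>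
      x ` {0..n} \<union> y ` {1..m} = (UNIV :: 'v set) \<and>
      (\<forall>a b. E a b \<longleftrightarrow>
         ((\<exists>i\<in>{1..n}. {a, b} = {x 0, x i}) \<or> (\<exists>i\<in>{1..m}. {a, b} = {x i, y i}))))"

type_synonym ('v, 'k) mpoly = "('v \<Rightarrow>\<^sub>0 nat) \<Rightarrow>\<^sub>0 'k"

definition var :: "'v \<Rightarrow> ('v, 'k::field) mpoly" where
  "var v = Poly_Mapping.single (Poly_Mapping.single v 1) 1"

definition homogeneous :: "nat \<Rightarrow> ('v, 'k::field) mpoly \<Rightarrow> bool" where
  "homogeneous d p \<longleftrightarrow> (\<forall>m\<in>Poly_Mapping.keys p. (\<Sum>v\<in>Poly_Mapping.keys m. Poly_Mapping.lookup m v) = d)"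

definition ideal_gen :: "('v, 'k::field) mpoly set \<Rightarrow> ('v, 'k) mpoly set" where
  "ideal_gen G = {p. \<exists>F c. finite F \<and> F \<subseteq> G \<and> p = (\<Sum>g\<in>F. c g * g)}"

definition edge_ideal :: "('v \<Rightarrow> 'v \<Rightarrow> bool) \<Rightarrow> ('v, 'k::field) mpoly set" where
  "edge_ideal E = ideal_gen {var u * var v | u v. E u v}"

definition free_vecs :: "nat \<Rightarrow> (nat \<Rightarrow> ('v, 'k::field) mpoly) set" where
  "free_vecs n = {w. \<forall>j\<ge>n. w j = 0}"

definition mat_apply :: "nat \<Rightarrow> nat \<Rightarrow> (nat \<Rightarrow> nat \<Rightarrow> ('v, 'k::field) mpoly)
    \<Rightarrow> (nat \<Rightarrow> ('v, 'k) mpoly) \<Rightarrow> (nat \<Rightarrow> ('v, 'k) mpoly)" where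
  "mat_apply m n M w = (\<lambda>r. if r < m then (\<Sum>c<n. M r c * w c) else 0)"

text \<open>An ideal I of S has a (2-)linear resolution: there is a graded free resolution
  0 \<rightarrow> F_p \<rightarrow> ... \<rightarrow> F_0 \<rightarrow> I \<rightarrow> 0 with F_i = S(-i-2)^{b_i}.
  Encoding: r 0 = 1 (the target S of the augmentation), F_i = S^{r (i+1)};
  d 0 is the 1 \<times> r 1 matrix of the augmentation F_0 \<rightarrow> S (entries forms of degree 2),
  d i (i \<ge> 1) is the r i \<times> r (i+1) matrix of F_i \<rightarrow> F_(i-1) (entries linear forms).
  The complex is exact, the augmentation has image I, and F_p \<rightarrow> F_(p-1) is injective.
  This is equivalent to beta_{i,j}(I) = 0 for j \<noteq> i + 2.\<close>
definition has_linear_resolution :: "('v, 'k::field) mpoly set \<Rightarrow> bool" where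
  "has_linear_resolution I \<longleftrightarrow> (\<exists>(p::nat) (r::nat \<Rightarrow> nat) (d::nat \<Rightarrow> nat \<Rightarrow> nat \<Rightarrow> ('v, 'k) mpoly).
      r 0 = 1 \<and>
      (\<forall>i\<le>p. \<forall>a b. homogeneous (if i = 0 then 2 else 1) (d i a b)) \<and>
      {(mat_apply (r 0) (r 1) (d 0) w) 0 | w. w \<in> free_vecs (r 1)} = I \<and>
      (\<forall>i<p. {w \<in> free_vecs (r (i + 1)). mat_apply (r i) (r (i + 1)) (d i) w = (\<lambda>_. 0)}
             = mat_apply (r (i + 1)) (r (i + 2)) (d (i + 1)) ` free_vecs (r (i + 2))) \<and>
      {w \<in> free_vecs (r (p + 1)). mat_apply (r p) (r (p + 1)) (d p) w = (\<lambda>_. 0)} = {\<lambda>_. 0})"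

end

(*
The square of a path with at most 5 vertices, of a star or of a whiskered star is a split graph: a
clique X meets every edge. Ordering the edges of a split graph by their larger end, X first, gives
linear quotients, and the horseshoe lemma turns these into a linear resolution; it also resolves the
ideals generated by variables that appear as colon ideals. Conversely, a linear resolution forbids
an induced pair of disjoint edges, because their Koszul syzygy is no combination of linear
syzygies. In the square of a tree this excludes a path on 6 vertices, a vertex of degree at least
3 next to the centre of a path on 5 vertices, and a double star with two leaves at each end; what
remains are stars and whiskered stars.
*)
theory Submission
  imports Defs
begin

subsection \<open>Monomials and graded components\<close>

text \<open>A resolution is handled as iterated kernels inside free modules, so that the horseshoe
  lemma becomes an induction on its length. The delicate point there is degree: a generator of the
  quotient lifts to some vector, and gradedness is what allows the lift to be replaced by its linear
  part. In the converse the generators of the resolution are arbitrary quadrics rather than edge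
  monomials, so the obstruction is read off by a linear functional on syzygies. In the tree, two
  edges of the square form a forbidden pair as soon as all four distances between their ends are at
  least 3; each excluded shape contains two such edges, joined in the tree directly or through a
  common neighbour.\<close>

definition monom_deg :: "('v \<Rightarrow>\<^sub>0 nat) \<Rightarrow> nat" where
  "monom_deg m = (\<Sum>v\<in>Poly_Mapping.keys m. Poly_Mapping.lookup m v)"

lemma monom_deg_add [simp]: "monom_deg (m + n) = monom_deg m + monom_deg n"
  unfolding monom_deg_def by (rule setsum_keys_plus_distrib) auto

lemma monom_deg_zero [simp]: "monom_deg 0 = 0"
  by (simp add: monom_deg_def)

lemma monom_deg_single [simp]: "monom_deg (Poly_Mapping.single v n) = n"
  by (simp add: monom_deg_def)

lemma single_one_eq_iff [simp]:
  "Poly_Mapping.single v (Suc 0) = Poly_Mapping.single w (Suc 0) \<longleftrightarrow> v = w"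
  by (metis lookup_single_eq lookup_single_not_eq nat.distinct(1))

lemma monom_deg_eq_0_iff: "monom_deg m = 0 \<longleftrightarrow> m = 0"
  by (auto simp: monom_deg_def in_keys_iff intro: poly_mapping_eqI)

lemma monom_deg_eq_1E:
  assumes "monom_deg m = 1"
  obtains v where "m = Poly_Mapping.single v 1"
proof -
  have "m \<noteq> 0" using assms by auto
  then obtain v where v: "Poly_Mapping.lookup m v \<noteq> 0"
    by (metis lookup_zero poly_mapping_eqI)
  define n where "n = m - Poly_Mapping.single v 1"
  have m: "m = Poly_Mapping.single v 1 + n"
    using v by (intro poly_mapping_eqI) (auto simp: n_def lookup_add lookup_minus lookup_single when_def)
  then have "monom_deg n = 0" using assms by (metis add_diff_cancel_left' diff_self_eq_0 monom_deg_add monom_deg_single)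
  then show ?thesis using m that by (simp add: monom_deg_eq_0_iff)
qed

lemma homogeneous_iff: "homogeneous d p \<longleftrightarrow> (\<forall>m\<in>Poly_Mapping.keys p. monom_deg m = d)"
  by (simp add: homogeneous_def monom_deg_def)

lemma homogeneous_zero [simp]: "homogeneous d 0"
  by (simp add: homogeneous_iff)

lemma homogeneous_single: "monom_deg m = d \<Longrightarrow> homogeneous d (Poly_Mapping.single m c)"
  by (simp add: homogeneous_iff)

lemma poly_mapping_sum_single:
  "p = (\<Sum>m\<in>Poly_Mapping.keys p. Poly_Mapping.single m (Poly_Mapping.lookup p m))"
  by (rule poly_mapping_eqI) (auto simp: lookup_sum lookup_single when_def in_keys_iff)

lemma lookup_single_mult:
  fixes p :: "('v, 'k::field) mpoly"
  shows "Poly_Mapping.lookup (Poly_Mapping.single s c * p) (s + t) = c * Poly_Mapping.lookup p t"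
proof -
  have "Poly_Mapping.single s c * p
      = (\<Sum>m\<in>Poly_Mapping.keys p. Poly_Mapping.single (s + m) (c * Poly_Mapping.lookup p m))"
    by (subst poly_mapping_sum_single [of p]) (simp only: sum_distrib_left mult_single)
  then show ?thesis
    by (simp add: lookup_sum lookup_single when_def in_keys_iff)
qed

lemma lookup_single_mult_not_dvd:
  fixes p :: "('v, 'k::field) mpoly"
  assumes "\<And>t. m \<noteq> s + t"
  shows "Poly_Mapping.lookup (Poly_Mapping.single s c * p) m = 0"
proof (rule ccontr)
  assume "Poly_Mapping.lookup (Poly_Mapping.single s c * p) m \<noteq> 0"
  then have "m \<in> Poly_Mapping.keys (Poly_Mapping.single s c * p)" by (simp add: in_keys_iff)
  then show False using keys_mult [of "Poly_Mapping.single s c" p] assms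
    by (auto split: if_splits)
qed

lemma keys_single_mult:
  fixes p :: "('v, 'k::field) mpoly"
  shows "Poly_Mapping.keys (Poly_Mapping.single g 1 * p) = (+) g ` Poly_Mapping.keys p"
proof (intro set_eqI iffI)
  fix m assume m: "m \<in> Poly_Mapping.keys (Poly_Mapping.single g 1 * p)"
  then obtain t where t: "m = g + t"
    using lookup_single_mult_not_dvd [of m g 1 p] by (auto simp: in_keys_iff)
  with m show "m \<in> (+) g ` Poly_Mapping.keys p"
    by (auto simp: in_keys_iff lookup_single_mult)
qed (auto simp: in_keys_iff lookup_single_mult)

section \<open>Homogeneous components and products with linear forms\<close>

lift_definition hpart :: "nat \<Rightarrow> ('v, 'k::field) mpoly \<Rightarrow> ('v, 'k) mpoly"
  is "\<lambda>d f m. f m when monom_deg m = d"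
  by simp

lemma lookup_hpart:
  "Poly_Mapping.lookup (hpart d p) m = (if monom_deg m = d then Poly_Mapping.lookup p m else 0)"
  by transfer simp

lemma hpart_zero [simp]: "hpart d 0 = 0"
  by (rule poly_mapping_eqI) (simp add: lookup_hpart)

lemma hpart_sum: "hpart d (sum f A) = (\<Sum>i\<in>A. hpart d (f i))"
  by (rule poly_mapping_eqI) (simp add: lookup_hpart lookup_sum)

lemma homogeneous_hpart [simp]: "homogeneous d (hpart d p)"
  by (auto simp: homogeneous_iff in_keys_iff lookup_hpart split: if_splits)

lemma hpart_homogeneous: "homogeneous d p \<Longrightarrow> hpart d p = p"
  by (rule poly_mapping_eqI) (auto simp: homogeneous_iff in_keys_iff lookup_hpart)

text \<open>A single term of degree \<open>e\<close> shifts every degree by \<open>e\<close>; the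
  general case sums over the terms of \<open>a\<close>. This makes kernels of matrices of forms
  graded.\<close>

lemma hpart_mult_homogeneous:
  fixes a p :: "('v, 'k::field) mpoly"
  assumes "homogeneous e a"
  shows "hpart (e + d) (a * p) = a * hpart d p"
proof -
  have single: "hpart (e + d) (Poly_Mapping.single m c * p) = Poly_Mapping.single m c * hpart d p"
    if "monom_deg m = e" for m :: "'v \<Rightarrow>\<^sub>0 nat" and c :: 'k
  proof (rule poly_mapping_eqI)
    fix k
    show "Poly_Mapping.lookup (hpart (e + d) (Poly_Mapping.single m c * p)) k
        = Poly_Mapping.lookup (Poly_Mapping.single m c * hpart d p) k"
    proof (cases "\<exists>t. k = m + t")
      case True
      then show ?thesis using that by (auto simp: lookup_hpart lookup_single_mult)
    next
      case False
      then show ?thesis by (simp add: lookup_hpart lookup_single_mult_not_dvd)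
    qed
  qed
  show ?thesis
    apply (subst (1 2) poly_mapping_sum_single [of a])
    unfolding sum_distrib_right hpart_sum
    using assms by (intro sum.cong refl single) (auto simp: homogeneous_iff)
qed

text \<open>A linear form is a combination of variables, and its term at x_v reaches
  \<open>m\<close> only if x_v divides \<open>m\<close>. Hence the truncated difference is a genuine
  quotient here.\<close>

lemma lookup_linear_mult:
  fixes s p :: "('v::finite, 'k::field) mpoly"
  assumes "homogeneous 1 s"
  shows "Poly_Mapping.lookup (s * p) m
    = (\<Sum>v\<in>Poly_Mapping.keys m. Poly_Mapping.lookup s (Poly_Mapping.single v 1)
        * Poly_Mapping.lookup p (m - Poly_Mapping.single v 1))"
proof -
  have s: "s = (\<Sum>v\<in>UNIV. Poly_Mapping.single (Poly_Mapping.single v 1)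
      (Poly_Mapping.lookup s (Poly_Mapping.single v 1)))"
  proof (rule poly_mapping_eqI)
    fix k
    show "Poly_Mapping.lookup s k = Poly_Mapping.lookup (\<Sum>v\<in>UNIV. Poly_Mapping.single
        (Poly_Mapping.single v 1) (Poly_Mapping.lookup s (Poly_Mapping.single v 1))) k"
    proof (cases "\<exists>v. k = Poly_Mapping.single v 1")
      case True
      then show ?thesis by (auto simp: lookup_sum lookup_single when_def)
    next
      case False
      then have "k \<notin> Poly_Mapping.keys s"
        using assms by (metis homogeneous_iff monom_deg_eq_1E)
      then show ?thesis using False
        by (auto simp: in_keys_iff lookup_sum lookup_single when_def intro!: sum.neutral)
    qed
  qed
  have one: "Poly_Mapping.lookup (Poly_Mapping.single (Poly_Mapping.single v 1) c * p) m
      = (if v \<in> Poly_Mapping.keys m then c * Poly_Mapping.lookup p (m - Poly_Mapping.single v 1) else 0)"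
    for v :: 'v and c :: 'k
  proof (cases "v \<in> Poly_Mapping.keys m")
    case True
    then have "m = Poly_Mapping.single v 1 + (m - Poly_Mapping.single v 1)"
      by (intro poly_mapping_eqI) (auto simp: lookup_add lookup_minus lookup_single when_def in_keys_iff)
    then show ?thesis using True lookup_single_mult by metis
  next
    case False
    then have "m \<noteq> Poly_Mapping.single v 1 + t" for t
      by (auto simp: in_keys_iff lookup_add)
    then show ?thesis using False by (simp add: lookup_single_mult_not_dvd)
  qed
  show ?thesis
    apply (subst s)
    by (simp add: sum_distrib_right lookup_sum one sum.If_cases del: One_nat_def)
qed

subsection \<open>Monomial ideals\<close>

definition multiples :: "('v \<Rightarrow>\<^sub>0 nat) set \<Rightarrow> ('v \<Rightarrow>\<^sub>0 nat) set" where
  "multiples M = {g + t | g t. g \<in> M}"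

text \<open>Membership is a condition on supports, which turns colon conditions on polynomials into
  conditions on exponents. For finite \<open>M\<close>, \<open>ideal_gen_monomials\<close>
  identifies this with the generated ideal.\<close>

definition monom_ideal :: "('v \<Rightarrow>\<^sub>0 nat) set \<Rightarrow> ('v, 'k::field) mpoly set" where
  "monom_ideal M = {p. Poly_Mapping.keys p \<subseteq> multiples M}"

lemma multiples_insert: "multiples (insert g M) = {g + t | t. True} \<union> multiples M"
  by (auto simp: multiples_def)

lemma multiples_empty [simp]: "multiples {} = {}"
  by (auto simp: multiples_def)

lemma monom_ideal_zero [simp]: "0 \<in> monom_ideal M"
  by (simp add: monom_ideal_def)

lemma monom_ideal_add: "p \<in> monom_ideal M \<Longrightarrow> q \<in> monom_ideal M \<Longrightarrow> p + q \<in> monom_ideal M"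
  using keys_add [of p q] by (auto simp: monom_ideal_def)

lemma monom_ideal_mult: "p \<in> monom_ideal M \<Longrightarrow> q * p \<in> monom_ideal M"
  using keys_mult [of q p] unfolding monom_ideal_def multiples_def
  by simp (smt (verit) add.left_commute mem_Collect_eq subset_iff)

lemma monom_ideal_uminus: "p \<in> monom_ideal M \<Longrightarrow> - p \<in> monom_ideal M"
  using monom_ideal_mult [of p M "-1"] by simp

lemma monom_ideal_sum: "(\<And>i. i \<in> A \<Longrightarrow> f i \<in> monom_ideal M) \<Longrightarrow> sum f A \<in> monom_ideal M"
  by (induction A rule: infinite_finite_induct) (auto intro: monom_ideal_add)

lemma monom_ideal_mono: "M \<subseteq> N \<Longrightarrow> monom_ideal M \<subseteq> monom_ideal N"
  unfolding monom_ideal_def multiples_def by blast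

lemma monom_ideal_single: "g \<in> M \<Longrightarrow> Poly_Mapping.single g c \<in> monom_ideal M"
  by (auto simp: monom_ideal_def multiples_def) (metis add.right_neutral)

text \<open>The terms of \<open>p\<close> divisible by an element of \<open>M\<close> make up
  \<open>q\<close>; each remaining term must be divisible by \<open>g\<close>.\<close>

lemma monom_ideal_insertE:
  fixes p :: "('v, 'k::field) mpoly"
  assumes "p \<in> monom_ideal (insert g M)"
  obtains q a where "q \<in> monom_ideal M" "p = q + Poly_Mapping.single g 1 * a"
proof -
  let ?A = "Poly_Mapping.keys p \<inter> multiples M"
  let ?B = "Poly_Mapping.keys p - multiples M"
  let ?s = "\<lambda>m. Poly_Mapping.single m (Poly_Mapping.lookup p m)"
  have "\<exists>t. m = g + t" if "m \<in> ?B" for m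
    using that assms by (auto simp: monom_ideal_def multiples_insert)
  then obtain t where t: "\<And>m. m \<in> ?B \<Longrightarrow> m = g + t m" by metis
  have "p = sum ?s ?A + sum ?s ?B"
    by (subst poly_mapping_sum_single [of p], subst sum.Int_Diff [where B = "multiples M"]) auto
  also have "sum ?s ?B = Poly_Mapping.single g 1 * (\<Sum>m\<in>?B. Poly_Mapping.single (t m) (Poly_Mapping.lookup p m))"
    unfolding sum_distrib_left mult_single using t by (intro sum.cong) auto
  finally have "p = sum ?s ?A + Poly_Mapping.single g 1 * (\<Sum>m\<in>?B. Poly_Mapping.single (t m) (Poly_Mapping.lookup p m))" .
  moreover have "sum ?s ?A \<in> monom_ideal M"
    by (rule monom_ideal_sum) (auto simp: monom_ideal_def)
  ultimately show ?thesis using that by blast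
qed

text \<open>The assumption describes the monomials of the colon ideal of \<open>M\<close> by
  \<open>g\<close>. Multiplication by \<open>g\<close> merely translates supports, so the
  description passes to polynomials.\<close>

lemma single_mult_in_monom_ideal_iff:
  assumes "\<And>t. g + t \<in> multiples M \<longleftrightarrow> t \<in> multiples N"
  shows "Poly_Mapping.single g 1 * p \<in> monom_ideal M \<longleftrightarrow> p \<in> monom_ideal N"
  using assms by (auto simp: monom_ideal_def keys_single_mult)

lemma monom_ideal_eq_sum:
  fixes p :: "('v, 'k::field) mpoly"
  assumes "finite M" "p \<in> monom_ideal M"
  shows "\<exists>c. p = (\<Sum>g\<in>M. c g * Poly_Mapping.single g 1)"
  using assms
proof (induction M arbitrary: p rule: finite_induct)
  case empty
  then show ?case by (simp add: monom_ideal_def)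
next
  case (insert g M)
  obtain q a where "q \<in> monom_ideal M" and p: "p = q + Poly_Mapping.single g 1 * a"
    using insert.prems by (rule monom_ideal_insertE)
  with insert.IH obtain c where c: "q = (\<Sum>g\<in>M. c g * Poly_Mapping.single g 1)" by blast
  have "(\<Sum>h\<in>M. (c(g := a)) h * Poly_Mapping.single h 1) = q"
    unfolding c using insert.hyps by (intro sum.cong) auto
  then have "p = (\<Sum>h\<in>insert g M. (c(g := a)) h * Poly_Mapping.single h 1)"
    unfolding sum.insert [OF insert.hyps] by (simp add: p mult.commute add.commute)
  then show ?case by blast
qed

lemma ideal_gen_monomials:
  fixes M :: "('v \<Rightarrow>\<^sub>0 nat) set"
  assumes "finite M"
  shows "ideal_gen ((\<lambda>g. Poly_Mapping.single g (1::'k::field)) ` M) = monom_ideal M"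
    (is "ideal_gen (?s ` M) = _")
proof (intro equalityI subsetI)
  fix p assume "p \<in> ideal_gen (?s ` M)"
  then obtain F c where F: "F \<subseteq> ?s ` M" and p: "p = (\<Sum>g\<in>F. c g * g)"
    by (auto simp: ideal_gen_def)
  show "p \<in> monom_ideal M" unfolding p
  proof (intro monom_ideal_sum monom_ideal_mult)
    fix q assume "q \<in> F"
    with F obtain g where "g \<in> M" "q = ?s g" by blast
    then show "q \<in> monom_ideal M" by (simp add: monom_ideal_single)
  qed
next
  \<comment> \<open>\<open>ideal_gen\<close> indexes coefficients by the generators themselves;
    injectivity carries over a family indexed by exponents.\<close>
  have inj: "inj_on ?s M"
    by (rule inj_onI) (metis keys_single singleton_inject zero_neq_one)
  fix p :: "('v, 'k) mpoly" assume "p \<in> monom_ideal M"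
  then obtain c where "p = (\<Sum>g\<in>M. c g * ?s g)" using monom_ideal_eq_sum [OF assms] by blast
  also have "\<dots> = (\<Sum>g\<in>M. c (the_inv_into M ?s (?s g)) * ?s g)"
    by (intro sum.cong) (simp_all only: the_inv_into_f_f [OF inj])
  also have "\<dots> = (\<Sum>h\<in>?s ` M. c (the_inv_into M ?s h) * h)"
    by (simp only: sum.reindex [OF inj] o_def)
  finally have "p = (\<Sum>h\<in>?s ` M. c (the_inv_into M ?s h) * h)" .
  moreover have "finite (?s ` M)" using assms by simp
  ultimately show "p \<in> ideal_gen (?s ` M)" unfolding ideal_gen_def
    by (intro CollectI exI [of _ "?s ` M"] exI [of _ "\<lambda>h. c (the_inv_into M ?s h)"] conjI order_refl)
qed

subsection \<open>Linear resolutions of submodules of free modules\<close>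

definition kernel :: "nat \<Rightarrow> nat \<Rightarrow> (nat \<Rightarrow> nat \<Rightarrow> ('v, 'k::field) mpoly) \<Rightarrow> (nat \<Rightarrow> ('v, 'k) mpoly) set" where
  "kernel m n D = {w \<in> free_vecs n. mat_apply m n D w = (\<lambda>_. 0)}"

abbreviation linear_matrix :: "(nat \<Rightarrow> nat \<Rightarrow> ('v, 'k::field) mpoly) \<Rightarrow> bool" where
  "linear_matrix D \<equiv> \<forall>a b. homogeneous 1 (D a b)"

text \<open>Iterated syzygies: \<open>K\<close> is spanned by linear columns, and the relations
  among these are resolved in the same way until nothing is left after \<open>p\<close> steps.
  Exactness is built in, each kernel being the next module.\<close>

primrec linear_res :: "nat \<Rightarrow> nat \<Rightarrow> (nat \<Rightarrow> ('v, 'k::field) mpoly) set \<Rightarrow> bool" where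
  "linear_res 0 n K \<longleftrightarrow> K = {\<lambda>_. 0}"
| "linear_res (Suc p) n K \<longleftrightarrow> (\<exists>n' D. linear_matrix D \<and> K = mat_apply n n' D ` free_vecs n' \<and>
     linear_res p n' (kernel n n' D))"

lemma zero_in_free_vecs [simp]: "(\<lambda>_. 0) \<in> free_vecs n"
  by (simp add: free_vecs_def)

lemma free_vecs_iff: "w \<in> free_vecs r \<longleftrightarrow> (\<forall>i. w (r + i) = 0)"
  by (auto simp: free_vecs_def le_iff_add)

lemma free_vecs_0: "free_vecs 0 = {\<lambda>_. 0}"
  by (auto simp: free_vecs_def)

lemma mat_apply_zero [simp]: "mat_apply m n D (\<lambda>_. 0) = (\<lambda>_. 0)"
  by (auto simp: mat_apply_def)

lemma linear_res_zero: "linear_res p n {\<lambda>_. 0 :: ('v, 'k::field) mpoly}"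
proof (induction p arbitrary: n)
  case (Suc p)
  have "kernel n 0 (\<lambda>_ _. 0 :: ('v, 'k) mpoly) = {\<lambda>_. 0}"
    by (auto simp: kernel_def free_vecs_0)
  with Suc have "linear_res p 0 (kernel n 0 (\<lambda>_ _. 0 :: ('v, 'k) mpoly))" by simp
  then show ?case unfolding linear_res.simps
    by (intro exI [of _ 0] exI [of _ "\<lambda>_ _. 0"] conjI) (simp_all add: free_vecs_0)
qed simp

text \<open>Padding by zero modules; it brings two resolutions to the common length that the
  horseshoe lemma asks for.\<close>

lemma linear_res_mono:
  assumes "linear_res p n K" "p \<le> q"
  shows "linear_res q n K"
  using assms
proof (induction p arbitrary: q n K)
  case 0
  then show ?case by (simp add: linear_res_zero)
next
  case (Suc p)
  then obtain q' where "q = Suc q'" "p \<le> q'" by (metis Suc_le_D Suc_le_mono)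
  moreover from Suc.prems(1) obtain n' D where "linear_matrix D"
    "K = mat_apply n n' D ` free_vecs n'" "linear_res p n' (kernel n n' D)"
    unfolding linear_res.simps by blast
  ultimately show ?case using Suc.IH unfolding \<open>q = Suc q'\<close> linear_res.simps by blast
qed

section \<open>Graded submodules and the horseshoe lemma\<close>

definition submodule :: "nat \<Rightarrow> (nat \<Rightarrow> ('v, 'k::field) mpoly) set \<Rightarrow> bool" where
  "submodule n K \<longleftrightarrow> K \<subseteq> free_vecs n \<and> (\<lambda>_. 0) \<in> K \<and>
    (\<forall>u\<in>K. \<forall>w\<in>K. (\<lambda>i. u i + w i) \<in> K) \<and> (\<forall>u\<in>K. \<forall>a. (\<lambda>i. a * u i) \<in> K)"

text \<open>The share of gradedness by which a lift of a linear vector can be replaced by a linear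
  one.\<close>

definition graded1 :: "(nat \<Rightarrow> ('v, 'k::field) mpoly) set \<Rightarrow> bool" where
  "graded1 K \<longleftrightarrow> (\<forall>u\<in>K. (\<lambda>i. hpart 1 (u i)) \<in> K)"

lemma submodule_add: "submodule n K \<Longrightarrow> u \<in> K \<Longrightarrow> w \<in> K \<Longrightarrow> (\<lambda>i. u i + w i) \<in> K"
  by (simp add: submodule_def)

lemma submodule_scale: "submodule n K \<Longrightarrow> u \<in> K \<Longrightarrow> (\<lambda>i. a * u i) \<in> K"
  by (simp add: submodule_def)

lemma submodule_minus:
  assumes "submodule n K" "u \<in> K" "w \<in> K"
  shows "(\<lambda>i. u i - w i) \<in> K"
  using submodule_add [OF assms(1,2) submodule_scale [OF assms(1,3), of "- 1"]] by simp

lemma submodule_sum: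
  assumes "submodule n K" "\<And>j. j < (m::nat) \<Longrightarrow> u j \<in> K"
  shows "(\<lambda>i. \<Sum>j<m. a j * u j i) \<in> K"
  using assms(2)
proof (induction m)
  case 0
  then show ?case using assms(1) by (simp add: submodule_def)
next
  case (Suc m)
  then have "(\<lambda>i. \<Sum>j<m. a j * u j i) \<in> K" by simp
  moreover have "(\<lambda>i. a m * u m i) \<in> K"
    using assms(1) by (rule submodule_scale) (simp add: Suc.prems)
  ultimately have "(\<lambda>i. (\<Sum>j<m. a j * u j i) + a m * u m i) \<in> K"
    using assms(1) by (intro submodule_add)
  then show ?case by simp
qed

lemma mat_apply_cong: "(\<And>j. j < n \<Longrightarrow> u j = w j) \<Longrightarrow> mat_apply m n D u = mat_apply m n D w"
  by (auto simp: mat_apply_def fun_eq_iff intro!: sum.cong)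

lemma mat_apply_add: "mat_apply m n D (\<lambda>i. u i + w i) = (\<lambda>i. mat_apply m n D u i + mat_apply m n D w i)"
  by (auto simp: mat_apply_def distrib_left sum.distrib)

lemma mat_apply_scale: "mat_apply m n D (\<lambda>i. a * u i) = (\<lambda>i. a * mat_apply m n D u i)"
  by (auto simp: mat_apply_def sum_distrib_left mult.left_commute)

lemma submodule_kernel: "submodule n (kernel m n D)"
  unfolding submodule_def kernel_def
  by (simp add: mat_apply_add mat_apply_scale) (simp add: free_vecs_def)

text \<open>Take the component of degree e + 1 of each relation. The case e = 1 serves the matrices
  of the resolution, e = d the row of generators.\<close>

lemma graded1_kernel:
  assumes "\<forall>a b. homogeneous e (D a b)"
  shows "graded1 (kernel m n D)"
  unfolding graded1_def
proof
  fix u assume u: "u \<in> kernel m n D"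
  have "(\<Sum>c<n. D r c * hpart 1 (u c)) = 0" if "r < m" for r
  proof -
    have "(\<Sum>c<n. D r c * u c) = 0" using u that
      by (auto simp: kernel_def mat_apply_def fun_eq_iff split: if_splits)
    then have "hpart (e + 1) (\<Sum>c<n. D r c * u c) = 0" by simp
    then show ?thesis unfolding hpart_sum using assms
      by (simp only: hpart_mult_homogeneous)
  qed
  then show "(\<lambda>i. hpart 1 (u i)) \<in> kernel m n D"
    using u by (simp add: kernel_def free_vecs_def mat_apply_def fun_eq_iff)
qed

lemma sum_lessThan_add:
  fixes f :: "nat \<Rightarrow> 'a::comm_monoid_add"
  shows "(\<Sum>i<m + n. f i) = (\<Sum>i<m. f i) + (\<Sum>j<n. f (m + j))"
  by (induction n) (simp_all add: add.assoc)

lemma mat_apply_unit: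
  assumes "j < n"
  shows "mat_apply m n D (\<lambda>i. if i = j then 1 else 0) = (\<lambda>i. if i < m then D i j else 0)"
proof -
  have "(\<Sum>c<n. D i c * (if c = j then 1 else 0)) = (\<Sum>c<n. if c = j then D i c else 0)" for i
    by (rule sum.cong) auto
  then show ?thesis using assms by (intro ext) (simp add: mat_apply_def)
qed

text \<open>The horseshoe lemma for the module presented by \<open>K\<close>, its submodule generated by the first
  \<open>r\<close> basis vectors and the quotient by that submodule.\<close>
lemma horseshoe:
  fixes K :: "(nat \<Rightarrow> ('v, 'k::field) mpoly) set"
  assumes "linear_res p r (K \<inter> free_vecs r)"
    and "linear_res p s ((\<lambda>w i. w (r + i)) ` K)"
    and "submodule (r + s) K" and "graded1 K"
  shows "linear_res p (r + s) K"
  using assms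
proof (induction p arbitrary: r s K)
  case 0
  have "w = (\<lambda>_. 0)" if w: "w \<in> K" for w
  proof -
    have "(\<lambda>i. w (r + i)) = (\<lambda>_. 0)" using 0(2) w by auto
    then have "w \<in> free_vecs r"
      by (simp add: free_vecs_iff fun_eq_iff)
    then show ?thesis using 0(1) w by auto
  qed
  then show ?case using 0(3) by (auto simp: submodule_def)
next
  case (Suc p)
  note sub = \<open>submodule (r + s) K\<close>
  from Suc.prems(1) obtain r' A where A: "linear_matrix A"
    and KA: "K \<inter> free_vecs r = mat_apply r r' A ` free_vecs r'"
    and resA: "linear_res p r' (kernel r r' A)" by auto
  from Suc.prems(2) obtain s' C where C: "linear_matrix C"
    and KC: "(\<lambda>w i. w (r + i)) ` K = mat_apply s s' C ` free_vecs s'"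
    and resC: "linear_res p s' (kernel s s' C)" by auto
  \<comment> \<open>Column \<open>j\<close> of \<open>C\<close> is lifted to \<open>K\<close>. The
    linear part of any lift is again a lift, since the column is already linear.\<close>
  have "\<exists>w. w \<in> K \<and> (\<forall>i. homogeneous 1 (w i)) \<and> (\<forall>i. w (r + i) = (if i < s then C i j else 0))"
    if "j < s'" for j
  proof -
    have "(\<lambda>i. if i = j then 1 else 0) \<in> free_vecs s'" using that by (auto simp: free_vecs_def)
    then have "(\<lambda>i. if i < s then C i j else 0) \<in> (\<lambda>w i. w (r + i)) ` K"
      unfolding KC mat_apply_unit [OF that, of s C, symmetric] by (rule imageI)
    then obtain w where w: "w \<in> K" "(\<lambda>i. w (r + i)) = (\<lambda>i. if i < s then C i j else 0)" by auto
    have "(\<lambda>i. hpart 1 (w i)) \<in> K" using \<open>graded1 K\<close> w(1) by (simp add: graded1_def)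
    moreover have "hpart 1 (w (r + i)) = (if i < s then C i j else 0)" for i
      using w(2) C by (auto simp: fun_eq_iff hpart_homogeneous simp del: One_nat_def)
    ultimately show ?thesis by (intro exI [of _ "\<lambda>i. hpart 1 (w i)"]) (simp del: One_nat_def)
  qed
  then obtain U where U: "\<And>j. j < s' \<Longrightarrow> U j \<in> K" "\<And>j i. j < s' \<Longrightarrow> homogeneous 1 (U j i)"
    "\<And>j i. j < s' \<Longrightarrow> U j (r + i) = (if i < s then C i j else 0)" by metis
  \<comment> \<open>Block triangular: the columns of \<open>A\<close> padded by zero rows, then the
    lifts. Further columns are zero because linearity is demanded at all indices and
    \<open>U\<close> is controlled only below \<open>s'\<close>.\<close>
  define D where "D = (\<lambda>i j. if j < r' then (if i < r then A i j else 0) else if j < r' + s' then U (j - r') i else 0)"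
  have D: "linear_matrix D" using A U(2) by (auto simp: D_def simp del: One_nat_def)
  have D_eq: "mat_apply (r + s) (r' + s') D w
      = (\<lambda>i. mat_apply r r' A w i + (\<Sum>j<s'. w (r' + j) * U j i))" for w
  proof
    fix i
    have "U j i = 0" if "\<not> i < r + s" "j < s'" for j
      using U(1) [OF that(2)] sub that(1) by (auto simp: submodule_def free_vecs_def)
    then show "mat_apply (r + s) (r' + s') D w i = mat_apply r r' A w i + (\<Sum>j<s'. w (r' + j) * U j i)"
      by (auto simp: mat_apply_def D_def sum_lessThan_add mult.commute)
  qed
  have trunc: "mat_apply r r' A (\<lambda>i. if i < r' then w i else 0) = mat_apply r r' A w" for w
    by (auto simp: mat_apply_def)
  have in_A: "mat_apply r r' A w \<in> K \<inter> free_vecs r" for w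
    unfolding KA by (subst trunc [symmetric]) (auto simp: free_vecs_def)
  have in_U: "(\<lambda>i. \<Sum>j<s'. w (r' + j) * U j i) \<in> K" for w
    using sub U(1) by (rule submodule_sum)
  have proj_U: "(\<Sum>j<s'. c j * U j (r + i)) = mat_apply s s' C c i" for c i
  proof -
    have "(\<Sum>j<s'. c j * U j (r + i)) = (\<Sum>j<s'. if i < s then C i j * c j else 0)"
      by (intro sum.cong) (simp_all add: U(3))
    then show ?thesis by (simp add: mat_apply_def)
  qed
  have image: "K = mat_apply (r + s) (r' + s') D ` free_vecs (r' + s')"
  proof (intro equalityI subsetI)
    fix w assume w: "w \<in> K"
    then have "(\<lambda>i. w (r + i)) \<in> mat_apply s s' C ` free_vecs s'"
      unfolding KC [symmetric] by (rule image_eqI [OF refl])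
    then obtain c where c: "c \<in> free_vecs s'" "(\<lambda>i. w (r + i)) = mat_apply s s' C c"
      by blast
    \<comment> \<open>Subtracting the lift of the last coordinates leaves an element of
      \<open>K\<close> supported on the first \<open>r\<close> coordinates, hence in the image of
      \<open>A\<close>.\<close>
    let ?v = "\<lambda>i. w i - (\<Sum>j<s'. c j * U j i)"
    have "?v \<in> K"
      by (rule submodule_minus [OF sub w]) (rule submodule_sum [OF sub U(1)])
    moreover have "?v (r + i) = 0" for i
      using fun_cong [OF c(2), of i] by (simp add: proj_U)
    then have "?v \<in> free_vecs r" by (simp add: free_vecs_iff)
    ultimately obtain a where a: "a \<in> free_vecs r'" "?v = mat_apply r r' A a" using KA by blast
    let ?z = "\<lambda>j. if j < r' then a j else c (j - r')"
    have za: "mat_apply r r' A ?z = mat_apply r r' A a" by (rule mat_apply_cong) simp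
    have "w = mat_apply (r + s) (r' + s') D ?z"
    proof
      fix i
      have "w i = mat_apply r r' A a i + (\<Sum>j<s'. c j * U j i)"
        using fun_cong [OF a(2), of i] by (simp only: diff_eq_eq)
      then show "w i = mat_apply (r + s) (r' + s') D ?z i"
        unfolding D_eq za by simp
    qed
    moreover have "?z \<in> free_vecs (r' + s')" using c(1) by (auto simp: free_vecs_def)
    ultimately show "w \<in> mat_apply (r + s) (r' + s') D ` free_vecs (r' + s')" by blast
  next
    fix w assume "w \<in> mat_apply (r + s) (r' + s') D ` free_vecs (r' + s')"
    then show "w \<in> K" using in_A by (auto simp: D_eq intro!: submodule_add [OF sub] in_U)
  qed
  \<comment> \<open>The kernel of \<open>D\<close> inherits the shape of \<open>K\<close>: its part
    in the first \<open>r'\<close> coordinates is the kernel of \<open>A\<close>, its projection to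
    the others is the kernel of \<open>C\<close>.\<close>
  have "kernel (r + s) (r' + s') D \<inter> free_vecs r' = kernel r r' A"
    by (auto simp: kernel_def D_eq free_vecs_def)
  moreover have "(\<lambda>w i. w (r' + i)) ` kernel (r + s) (r' + s') D = kernel s s' C"
  proof (intro equalityI subsetI)
    fix c assume "c \<in> (\<lambda>w i. w (r' + i)) ` kernel (r + s) (r' + s') D"
    then obtain w where w: "w \<in> free_vecs (r' + s')" "c = (\<lambda>i. w (r' + i))"
      "\<And>i. mat_apply r r' A w i + (\<Sum>j<s'. w (r' + j) * U j i) = 0"
      by (auto simp: kernel_def D_eq fun_eq_iff)
    have "mat_apply s s' C c = (\<lambda>_. 0)"
    proof
      fix i show "mat_apply s s' C c i = 0"
        using w(3) [of "r + i"] proj_U [of c i] w(2) by (simp add: mat_apply_def)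
    qed
    then show "c \<in> kernel s s' C" using w by (auto simp: kernel_def free_vecs_def)
  next
    fix c assume c: "c \<in> kernel s s' C"
    \<comment> \<open>A relation among the columns of \<open>C\<close> combines their lifts to a
      vector in the image of \<open>A\<close>; prefixing its negated coordinates gives a relation
      among the columns of \<open>D\<close>.\<close>
    let ?v = "\<lambda>i. \<Sum>j<s'. c j * U j i"
    have "?v \<in> K" by (rule submodule_sum [OF sub U(1)])
    moreover have "?v (r + i) = 0" for i
      using c by (simp add: proj_U kernel_def)
    then have "?v \<in> free_vecs r" by (simp add: free_vecs_iff)
    ultimately obtain a where a: "a \<in> free_vecs r'" "?v = mat_apply r r' A a" using KA by blast
    let ?z = "\<lambda>j. if j < r' then - a j else c (j - r')"
    have za: "mat_apply r r' A ?z = mat_apply r r' A (\<lambda>j. - 1 * a j)" by (rule mat_apply_cong) simp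
    have "mat_apply (r + s) (r' + s') D ?z = (\<lambda>_. 0)"
      unfolding D_eq za mat_apply_scale a(2) [symmetric] by simp
    then have "?z \<in> kernel (r + s) (r' + s') D" using c by (auto simp: kernel_def free_vecs_def)
    then show "c \<in> (\<lambda>w i. w (r' + i)) ` kernel (r + s) (r' + s') D"
      by (rule image_eqI [rotated]) simp
  qed
  ultimately have "linear_res p (r' + s') (kernel (r + s) (r' + s') D)"
    using resA resC submodule_kernel graded1_kernel [OF D] by (intro Suc.IH) auto
  with D image show ?case unfolding linear_res.simps by blast
qed

subsection \<open>Linear quotients\<close>

text \<open>Generators of degree \<open>d\<close> whose iterated syzygies are linear: d = 2 for edge
  ideals, d = 1 for colon ideals. \<open>w\<close> ranges over all sequences since only its first
  \<open>r\<close> entries are read.\<close>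

definition linear_presentation :: "nat \<Rightarrow> ('v, 'k::field) mpoly set \<Rightarrow> bool" where
  "linear_presentation d I \<longleftrightarrow> (\<exists>r f p. (\<forall>i. homogeneous d (f i)) \<and>
     (\<forall>q. q \<in> I \<longleftrightarrow> (\<exists>w. q = (\<Sum>c<r. f c * w c))) \<and> linear_res p r (kernel 1 r (\<lambda>_. f)))"

lemma kernel_row_iff: "w \<in> kernel 1 r (\<lambda>_. f) \<longleftrightarrow> w \<in> free_vecs r \<and> (\<Sum>c<r. f c * w c) = 0"
  by (auto simp: kernel_def mat_apply_def fun_eq_iff)

lemma sum_row_truncate:
  fixes f w :: "nat \<Rightarrow> ('v, 'k::field) mpoly"
  obtains w' where "w' \<in> free_vecs r" "(\<Sum>c<r. f c * w' c) = (\<Sum>c<r. f c * w c)"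
proof
  show "(\<lambda>i. if i < r then w i else 0) \<in> free_vecs r" by (simp add: free_vecs_def)
qed simp

text \<open>Seen as a submodule of the free module of rank 1, an ideal has its row of linear
  generators as one more linear matrix. In this form a colon ideal enters the horseshoe
  lemma.\<close>

lemma linear_presentation_ideal:
  fixes I :: "('v, 'k::field) mpoly set"
  assumes "linear_presentation 1 I"
  obtains p where "linear_res p 1 {w \<in> free_vecs 1. w 0 \<in> I}"
proof -
  from assms obtain r p and f :: "nat \<Rightarrow> ('v, 'k) mpoly" where f: "\<forall>i. homogeneous 1 (f i)"
    "\<And>q. q \<in> I \<longleftrightarrow> (\<exists>w. q = (\<Sum>c<r. f c * w c))" "linear_res p r (kernel 1 r (\<lambda>_. f))"
    unfolding linear_presentation_def by blast
  have "{w \<in> free_vecs 1. w 0 \<in> I} = mat_apply 1 r (\<lambda>_. f) ` free_vecs r"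
  proof (intro equalityI subsetI)
    fix w assume w: "w \<in> {w \<in> free_vecs 1. w 0 \<in> I}"
    then obtain z where z: "w 0 = (\<Sum>c<r. f c * z c)" using f(2) by blast
    obtain z' where z': "z' \<in> free_vecs r" "(\<Sum>c<r. f c * z' c) = (\<Sum>c<r. f c * z c)"
      by (rule sum_row_truncate)
    have "w = mat_apply 1 r (\<lambda>_. f) z'"
      using w z z'(2) by (intro ext) (auto simp: mat_apply_def free_vecs_def)
    then show "w \<in> mat_apply 1 r (\<lambda>_. f) ` free_vecs r" using z'(1) by blast
  next
    fix w assume "w \<in> mat_apply 1 r (\<lambda>_. f) ` free_vecs r"
    then obtain z where z: "w = mat_apply 1 r (\<lambda>_. f) z" by blast
    then have "w 0 = (\<Sum>c<r. f c * z c)" by (simp add: mat_apply_def)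
    then have "w 0 \<in> I" using f(2) by blast
    then show "w \<in> {w \<in> free_vecs 1. w 0 \<in> I}" by (simp add: z mat_apply_def free_vecs_def)
  qed
  then have "linear_res (Suc p) 1 {w \<in> free_vecs 1. w 0 \<in> I}"
    unfolding linear_res.simps using f(1,3) by (intro exI [of _ r] exI [of _ "\<lambda>_. f"] conjI) simp_all
  then show ?thesis using that by blast
qed

lemma linear_presentation_empty: "linear_presentation d (monom_ideal {} :: ('v, 'k::field) mpoly set)"
proof -
  have "kernel 1 0 (\<lambda>_ _. 0 :: ('v, 'k) mpoly) = {\<lambda>_. 0}"
    by (auto simp: kernel_def free_vecs_0)
  then show ?thesis unfolding linear_presentation_def
    by (intro exI [of _ 0] exI [of _ "\<lambda>_. 0"] conjI) (simp_all add: monom_ideal_def)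
qed

text \<open>If the colon ideal \<open>(M) : g\<close> has a linear resolution, then the syzygies of \<open>M \<union> {g}\<close> are an
  extension of that ideal by the syzygies of \<open>M\<close>, and the horseshoe lemma applies.\<close>
lemma linear_presentation_insert:
  fixes M N :: "('v \<Rightarrow>\<^sub>0 nat) set"
  assumes "linear_presentation d (monom_ideal M :: ('v, 'k::field) mpoly set)"
    and "linear_presentation 1 (monom_ideal N :: ('v, 'k) mpoly set)"
    and colon: "\<And>t. g + t \<in> multiples M \<longleftrightarrow> t \<in> multiples N"
    and "monom_deg g = d"
  shows "linear_presentation d (monom_ideal (insert g M) :: ('v, 'k) mpoly set)"
proof -
  let ?g = "Poly_Mapping.single g (1::'k)"
  from assms(1) obtain r p and f :: "nat \<Rightarrow> ('v, 'k) mpoly" where f: "\<forall>i. homogeneous d (f i)"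
    and img: "\<And>q. q \<in> monom_ideal M \<longleftrightarrow> (\<exists>w. q = (\<Sum>c<r. f c * w c))"
    and res: "linear_res p r (kernel 1 r (\<lambda>_. f))"
    unfolding linear_presentation_def by blast
  obtain p' where res': "linear_res p' 1 {w \<in> free_vecs 1. w 0 \<in> (monom_ideal N :: ('v, 'k) mpoly set)}"
    using assms(2) by (rule linear_presentation_ideal)
  \<comment> \<open>The new generator takes the last index, so that the syzygies with vanishing last
    coordinate are those of \<open>M\<close>.\<close>
  define h where "h = f(r := ?g)"
  have h: "\<forall>i. homogeneous d (h i)"
    using f assms(4) by (simp add: h_def homogeneous_single)
  have sum_h: "(\<Sum>c<Suc r. h c * w c) = (\<Sum>c<r. f c * w c) + ?g * w r" for w
    by (simp add: h_def)
  have img_h: "q \<in> monom_ideal (insert g M) \<longleftrightarrow> (\<exists>w. q = (\<Sum>c<Suc r. h c * w c))" for q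
  proof
    assume "q \<in> monom_ideal (insert g M)"
    then obtain s a where s: "s \<in> monom_ideal M" "q = s + ?g * a" by (rule monom_ideal_insertE)
    then obtain w where "s = (\<Sum>c<r. f c * w c)" using img by blast
    then have "q = (\<Sum>c<Suc r. h c * (w(r := a)) c)" unfolding sum_h by (simp add: s)
    then show "\<exists>w. q = (\<Sum>c<Suc r. h c * w c)" by blast
  next
    assume "\<exists>w. q = (\<Sum>c<Suc r. h c * w c)"
    then obtain w where w: "q = (\<Sum>c<r. f c * w c) + ?g * w r" unfolding sum_h by blast
    have "(\<Sum>c<r. f c * w c) \<in> monom_ideal M" using img by blast
    then have "(\<Sum>c<r. f c * w c) \<in> monom_ideal (insert g M)"
      using monom_ideal_mono [of M "insert g M"] by blast
    then show "q \<in> monom_ideal (insert g M)" unfolding w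
      by (subst mult.commute) (intro monom_ideal_add monom_ideal_mult monom_ideal_single, auto)
  qed
  let ?K = "kernel 1 (r + 1) (\<lambda>_. h)"
  have K: "w \<in> ?K \<longleftrightarrow> w \<in> free_vecs (r + 1) \<and> (\<Sum>c<r. f c * w c) + ?g * w r = 0" for w
    unfolding sum_h [symmetric] by (simp only: kernel_row_iff Suc_eq_plus1)
  have "?K \<inter> free_vecs r = kernel 1 r (\<lambda>_. f)"
    by (intro set_eqI) (auto simp: K kernel_row_iff [of _ r f] free_vecs_def simp del: One_nat_def)
  \<comment> \<open>A polynomial is the last coordinate of a syzygy exactly when its product with
    \<open>?g\<close> is a combination of the old generators, that is, when it lies in the colon
    ideal.\<close>
  moreover have "(\<lambda>w i. w (r + i)) ` ?K = {w \<in> free_vecs 1. w 0 \<in> monom_ideal N}"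
  proof (intro equalityI subsetI)
    fix c assume "c \<in> (\<lambda>w i. w (r + i)) ` ?K"
    then obtain w where w: "w \<in> ?K" "c = (\<lambda>i. w (r + i))" by blast
    have "(\<Sum>c<r. f c * w c) \<in> monom_ideal M" using img by blast
    then have "- (\<Sum>c<r. f c * w c) \<in> monom_ideal M" by (rule monom_ideal_uminus)
    moreover have "- (\<Sum>c<r. f c * w c) = ?g * w r"
      using w(1) unfolding K by (simp add: neg_eq_iff_add_eq_0)
    ultimately have "w r \<in> monom_ideal N"
      using single_mult_in_monom_ideal_iff [OF colon] by metis
    then show "c \<in> {w \<in> free_vecs 1. w 0 \<in> monom_ideal N}"
      using w(1) unfolding K w(2) by (simp add: free_vecs_def)
  next
    fix c assume c: "c \<in> {w \<in> free_vecs 1. w 0 \<in> (monom_ideal N :: ('v, 'k) mpoly set)}"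
    then have "?g * c 0 \<in> monom_ideal M"
      using single_mult_in_monom_ideal_iff [OF colon] by blast
    then have "- (?g * c 0) \<in> monom_ideal M" by (rule monom_ideal_uminus)
    then obtain w where w: "- (?g * c 0) = (\<Sum>c<r. f c * w c)" using img by blast
    let ?z = "\<lambda>i. if i < r then w i else c (i - r)"
    have "?z \<in> ?K" unfolding K using c by (simp add: w [symmetric] free_vecs_def)
    then show "c \<in> (\<lambda>w i. w (r + i)) ` ?K" by (rule image_eqI [rotated]) simp
  qed
  ultimately have "linear_res (max p p') (r + 1) ?K"
    using linear_res_mono [OF res max.cobounded1] linear_res_mono [OF res' max.cobounded2]
    by (intro horseshoe submodule_kernel graded1_kernel [of d]) (simp_all add: h)
  then show ?thesis unfolding linear_presentation_def using h img_h
    by (intro exI [of _ "r + 1"] exI [of _ h] exI [of _ "max p p'"]) (simp del: sum.lessThan_Suc)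
qed

lemma multiples_vars: "t \<in> multiples ((\<lambda>v. Poly_Mapping.single v 1) ` V) \<longleftrightarrow> (\<exists>v\<in>V. v \<in> Poly_Mapping.keys t)"
proof
  assume "t \<in> multiples ((\<lambda>v. Poly_Mapping.single v 1) ` V)"
  then obtain v s where "v \<in> V" "t = Poly_Mapping.single v 1 + s" by (auto simp: multiples_def)
  then show "\<exists>v\<in>V. v \<in> Poly_Mapping.keys t"
    by (intro bexI [of _ v]) (simp_all add: in_keys_iff lookup_add)
next
  assume "\<exists>v\<in>V. v \<in> Poly_Mapping.keys t"
  then obtain v where v: "v \<in> V" "v \<in> Poly_Mapping.keys t" by blast
  then have "t = Poly_Mapping.single v 1 + (t - Poly_Mapping.single v 1)"
    by (intro poly_mapping_eqI) (auto simp: lookup_add lookup_minus lookup_single when_def in_keys_iff)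
  then show "t \<in> multiples ((\<lambda>v. Poly_Mapping.single v 1) ` V)"
    using v(1) unfolding multiples_def by blast
qed

text \<open>For a new variable x_v, a monomial times x_v lies in the ideal of \<open>V\<close> only
  if the monomial does. The colon ideal is thus the ideal of \<open>V\<close> itself, and the
  induction hypothesis fills both places.\<close>

lemma linear_presentation_vars:
  assumes "finite V"
  shows "linear_presentation 1 (monom_ideal ((\<lambda>v. Poly_Mapping.single v 1) ` V) :: ('v, 'k::field) mpoly set)"
  using assms
proof (induction V rule: finite_induct)
  case empty
  show ?case using linear_presentation_empty by simp
next
  case (insert v V)
  have "Poly_Mapping.single v 1 + t \<in> multiples ((\<lambda>v. Poly_Mapping.single v 1) ` V)
      \<longleftrightarrow> t \<in> multiples ((\<lambda>v. Poly_Mapping.single v 1) ` V)" for t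
    using insert.hyps(2) unfolding multiples_vars
    by (intro bex_cong) (auto simp: in_keys_iff lookup_add lookup_single when_def)
  then show ?case unfolding image_insert
    using monom_deg_single by (rule linear_presentation_insert [OF insert.IH insert.IH])
qed

section \<open>From iterated syzygies to a resolution of the ideal\<close>

lemma linear_res_chain:
  fixes K :: "(nat \<Rightarrow> ('v, 'k::field) mpoly) set"
  assumes "linear_res p n K"
  shows "\<exists>r D Z. r 0 = n \<and> Z 0 = K \<and> Z p = {\<lambda>_. 0} \<and> (\<forall>i<p. linear_matrix (D i) \<and>
    Z i = mat_apply (r i) (r (Suc i)) (D i) ` free_vecs (r (Suc i)) \<and>
    Z (Suc i) = kernel (r i) (r (Suc i)) (D i))"
  using assms
proof (induction p arbitrary: n K)
  case 0
  then show ?case by (intro exI [of _ "\<lambda>_. n"] exI exI [of _ "\<lambda>_. K"]) simp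
next
  case (Suc p)
  then obtain n' D where D: "linear_matrix D" "K = mat_apply n n' D ` free_vecs n'"
    and "linear_res p n' (kernel n n' D)" unfolding linear_res.simps by blast
  from Suc.IH [OF this(3)] obtain r D' Z where chain: "r 0 = n' \<and> Z 0 = kernel n n' D \<and> Z p = {\<lambda>_. 0} \<and>
    (\<forall>i<p. linear_matrix (D' i) \<and>
      Z i = mat_apply (r i) (r (Suc i)) (D' i) ` free_vecs (r (Suc i)) \<and>
      Z (Suc i) = kernel (r i) (r (Suc i)) (D' i))" by (elim exE)
  then have *: "r 0 = n'" "Z 0 = kernel n n' D" "Z p = {\<lambda>_. 0}" by simp_all
  show ?case
  proof (intro exI [of _ "case_nat n r"] exI [of _ "case_nat D D'"] exI [of _ "case_nat K Z"] conjI allI impI)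
    fix i assume i: "i < Suc p"
    show "homogeneous 1 (case_nat D D' i a b)" for a b
      using i D * chain by (cases i) (simp_all del: One_nat_def)
    show "case_nat K Z i = mat_apply (case_nat n r i) (case_nat n r (Suc i)) (case_nat D D' i) ` free_vecs (case_nat n r (Suc i))"
      using i D * chain by (cases i) simp_all
    show "case_nat K Z (Suc i) = kernel (case_nat n r i) (case_nat n r (Suc i)) (case_nat D D' i)"
      using i D * chain by (cases i) simp_all
  qed (simp_all add: *)
qed

lemma linear_presentation_imp_linear_resolution:
  fixes I :: "('v, 'k::field) mpoly set"
  assumes "linear_presentation 2 I"
  shows "has_linear_resolution I"
proof -
  from assms obtain n p and f :: "nat \<Rightarrow> ('v, 'k) mpoly" where f: "\<And>i. homogeneous 2 (f i)"
    and img: "\<And>q. q \<in> I \<longleftrightarrow> (\<exists>w. q = (\<Sum>c<n. f c * w c))"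
    and res: "linear_res p n (kernel 1 n (\<lambda>_. f))"
    unfolding linear_presentation_def by blast
  from linear_res_chain [OF res] obtain r D Z where chain: "r 0 = n \<and> Z 0 = kernel 1 n (\<lambda>_. f) \<and>
    Z p = {\<lambda>_. 0} \<and> (\<forall>i<p. linear_matrix (D i) \<and>
    Z i = mat_apply (r i) (r (Suc i)) (D i) ` free_vecs (r (Suc i)) \<and>
    Z (Suc i) = kernel (r i) (r (Suc i)) (D i))" by (elim exE)
  from chain have r: "r 0 = n" and Z: "Z 0 = kernel 1 n (\<lambda>_. f)" "Z p = {\<lambda>_. 0}"
    by simp_all
  from chain have D: "linear_matrix (D i)"
      "Z i = mat_apply (r i) (r (Suc i)) (D i) ` free_vecs (r (Suc i))"
      "Z (Suc i) = kernel (r i) (r (Suc i)) (D i)" if "i < p" for i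
    using that by blast+
  \<comment> \<open>The augmentation row \<open>f\<close> becomes stage 0 and everything else moves
    up by one. Then \<open>Z i\<close> is the kernel of \<open>d i\<close>, and the vanishing of
    \<open>Z p\<close> makes the last map injective.\<close>
  define r' where "r' = case_nat 1 r"
  define d where "d = case_nat (\<lambda>_. f) D"
  have kernel_d: "{w \<in> free_vecs (r' (i + 1)). mat_apply (r' i) (r' (i + 1)) (d i) w = (\<lambda>_. 0)} = Z i" if "i \<le> p" for i
    using that by (cases i) (simp_all add: r'_def d_def r Z D(3) kernel_def)
  show ?thesis unfolding has_linear_resolution_def
  proof (intro exI [of _ p] exI [of _ r'] exI [of _ d] conjI allI impI)
    show "r' 0 = 1" by (simp add: r'_def)
    show "homogeneous (if i = 0 then 2 else 1) (d i a b)" if "i \<le> p" for i a b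
      using that f D(1) by (cases i) (simp_all add: d_def del: One_nat_def)
    show "{mat_apply (r' 0) (r' 1) (d 0) w 0 | w. w \<in> free_vecs (r' 1)} = I"
    proof (intro equalityI subsetI)
      fix q assume "q \<in> I"
      then obtain w where w: "q = (\<Sum>c<n. f c * w c)" using img by blast
      obtain w' where w': "w' \<in> free_vecs n" "(\<Sum>c<n. f c * w' c) = (\<Sum>c<n. f c * w c)"
        by (rule sum_row_truncate)
      have "q = mat_apply (r' 0) (r' 1) (d 0) w' 0" by (simp add: mat_apply_def r'_def d_def r w w')
      moreover have "w' \<in> free_vecs (r' 1)" using w' by (simp add: r'_def r)
      ultimately show "q \<in> {mat_apply (r' 0) (r' 1) (d 0) w 0 | w. w \<in> free_vecs (r' 1)}" by blast
    next
      fix q assume "q \<in> {mat_apply (r' 0) (r' 1) (d 0) w 0 | w. w \<in> free_vecs (r' 1)}"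
      then obtain w where "q = mat_apply (r' 0) (r' 1) (d 0) w 0" by blast
      then have "q = (\<Sum>c<n. f c * w c)" by (simp add: mat_apply_def r'_def d_def r)
      then show "q \<in> I" using img by blast
    qed
    show "{w \<in> free_vecs (r' (i + 1)). mat_apply (r' i) (r' (i + 1)) (d i) w = (\<lambda>_. 0)}
        = mat_apply (r' (i + 1)) (r' (i + 2)) (d (i + 1)) ` free_vecs (r' (i + 2))" if "i < p" for i
    proof -
      have "i \<le> p" using that by simp
      then show ?thesis unfolding kernel_d [OF \<open>i \<le> p\<close>] using D(2) [OF that] by (simp add: r'_def d_def)
    qed
    show "{w \<in> free_vecs (r' (p + 1)). mat_apply (r' p) (r' (p + 1)) (d p) w = (\<lambda>_. 0)} = {\<lambda>_. 0}"
      unfolding kernel_d [OF order_refl] by (rule Z)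
  qed
qed

subsection \<open>Edge ideals\<close>

definition edge_monom :: "'v \<times> 'v \<Rightarrow> 'v \<Rightarrow>\<^sub>0 nat" where
  "edge_monom = (\<lambda>(u, v). Poly_Mapping.single u 1 + Poly_Mapping.single v 1)"

lemma edge_monom_commute: "edge_monom (u, v) = edge_monom (v, u)"
  by (simp add: edge_monom_def add.commute)

lemma var_mult_var: "var u * var v = Poly_Mapping.single (edge_monom (u, v)) 1"
  by (simp add: var_def edge_monom_def mult_single)

lemma edge_ideal_eq_monom_ideal:
  fixes E :: "'v::finite \<Rightarrow> 'v \<Rightarrow> bool"
  shows "edge_ideal E = (monom_ideal (edge_monom ` {(u, v). E u v}) :: ('v, 'k::field) mpoly set)"
proof -
  have "{var u * var v | u v. E u v}
      = (\<lambda>g. Poly_Mapping.single g (1::'k)) ` edge_monom ` {(u, v). E u v}"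
    by (auto simp: var_mult_var image_image)
  then show ?thesis by (simp add: edge_ideal_def ideal_gen_monomials)
qed

text \<open>Since its two variables differ, an edge monomial is squarefree, and divisibility depends
  on the support alone.\<close>

lemma in_multiples_edges:
  assumes "\<And>a b. (a, b) \<in> A \<Longrightarrow> a \<noteq> b"
  shows "t \<in> multiples (edge_monom ` A)
    \<longleftrightarrow> (\<exists>(a, b)\<in>A. a \<in> Poly_Mapping.keys t \<and> b \<in> Poly_Mapping.keys t)"
proof
  assume "t \<in> multiples (edge_monom ` A)"
  then obtain a b s where ab: "(a, b) \<in> A" "t = edge_monom (a, b) + s" by (auto simp: multiples_def)
  then have "a \<in> Poly_Mapping.keys t" "b \<in> Poly_Mapping.keys t"
    by (simp_all add: in_keys_iff lookup_add edge_monom_def)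
  with ab(1) show "\<exists>(a, b)\<in>A. a \<in> Poly_Mapping.keys t \<and> b \<in> Poly_Mapping.keys t" by blast
next
  assume "\<exists>(a, b)\<in>A. a \<in> Poly_Mapping.keys t \<and> b \<in> Poly_Mapping.keys t"
  then obtain a b where ab: "(a, b) \<in> A" "a \<in> Poly_Mapping.keys t" "b \<in> Poly_Mapping.keys t" by blast
  then have "t = edge_monom (a, b) + (t - edge_monom (a, b))"
    using assms [OF ab(1)]
    by (intro poly_mapping_eqI)
      (auto simp: edge_monom_def lookup_add lookup_minus lookup_single when_def in_keys_iff)
  then show "t \<in> multiples (edge_monom ` A)" using ab(1) unfolding multiples_def by blast
qed

subsection \<open>Split graphs\<close>

definition split_graph :: "('v \<Rightarrow> 'v \<Rightarrow> bool) \<Rightarrow> bool" where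
  "split_graph E \<longleftrightarrow> (\<exists>X. (\<forall>a\<in>X. \<forall>b\<in>X. a \<noteq> b \<longrightarrow> E a b) \<and> (\<forall>a b. E a b \<longrightarrow> a \<in> X \<or> b \<in> X))"

text \<open>Rank the vertices with the clique \<open>X\<close> first and add the edges by increasing larger end.
  If \<open>{u, v}\<close> is added after a disjoint edge \<open>{a, b}\<close>, then \<open>u \<in> X\<close>, and a vertex \<open>c \<in> {a, b} \<inter> X\<close>
  gives the earlier edge \<open>{u, c}\<close>: every colon ideal is generated by variables.\<close>
lemma split_graph_linear_presentation:
  fixes E :: "'v::finite \<Rightarrow> 'v \<Rightarrow> bool" and rk :: "'v \<Rightarrow> nat"
  assumes clique: "\<And>a b. a \<in> X \<Longrightarrow> b \<in> X \<Longrightarrow> a \<noteq> b \<Longrightarrow> E a b"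
    and cover: "\<And>a b. E a b \<Longrightarrow> a \<in> X \<or> b \<in> X"
    and inj: "inj rk" and X_first: "\<And>a b. b \<in> X \<Longrightarrow> rk a < rk b \<Longrightarrow> a \<in> X"
    and A: "A \<subseteq> {(a, b). E a b \<and> rk a < rk b}"
    and closed: "\<And>a b c d. (a, b) \<in> A \<Longrightarrow> E c d \<Longrightarrow> rk c < rk d \<Longrightarrow> rk d < rk b \<Longrightarrow> (c, d) \<in> A"
  shows "linear_presentation 2 (monom_ideal (edge_monom ` A) :: ('v, 'k::field) mpoly set)"
proof -
  have "finite A" by simp
  then show ?thesis using A closed
  proof (induction "card A" arbitrary: A)
    case 0
    then show ?case using linear_presentation_empty by simp
  next
    case (Suc n)
    have "A \<noteq> {}" using Suc.hyps(2) by auto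
    \<comment> \<open>Removing an edge whose larger end has maximal rank keeps the set closed,
      because closure concerns strictly smaller larger ends; edges with the same larger end may come
      in any order.\<close>
    define R where "R = Max (rk ` snd ` A)"
    have "R \<in> rk ` snd ` A" unfolding R_def using \<open>A \<noteq> {}\<close> by (intro Max_in) auto
    then obtain u v where uv: "(u, v) \<in> A" "rk v = R" by auto
    have max: "rk b \<le> rk v" if "(a, b) \<in> A" for a b
      unfolding uv(2) R_def using that by (intro Max_ge) (auto simp: image_iff intro!: bexI [of _ "(a, b)"])
    have Euv: "E u v" "rk u < rk v" using uv Suc.prems by auto
    define B where "B = A - {(u, v)}"
    have A_eq: "A = insert (u, v) B" and "(u, v) \<notin> B" using uv by (auto simp: B_def)
    have B_sub: "B \<subseteq> {(a, b). E a b \<and> rk a < rk b}" using Suc.prems(2) by (auto simp: B_def)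
    have early: "(c, d) \<in> B" if "E c d" "rk c < rk d" "rk d < rk v" for c d
      using Suc.prems(3) [OF uv(1) that] that(3) by (auto simp: B_def)
    \<comment> \<open>The generators of the colon ideal: the variables of those vertices that form
      an earlier edge with \<open>u\<close> or \<open>v\<close>.\<close>
    define V where "V = {w. w \<noteq> u \<and> w \<noteq> v \<and> (\<exists>(a, b)\<in>B. {a, b} = {w, u} \<or> {a, b} = {w, v})}"
    have "n = card B" using Suc.hyps(2) uv(1) by (simp add: B_def)
    then have IH: "linear_presentation 2 (monom_ideal (edge_monom ` B) :: ('v, 'k) mpoly set)"
    proof (rule Suc.hyps(1))
      fix a b c d assume "(a, b) \<in> B" "E c d" "rk c < rk d" "rk d < rk b"
      moreover have "rk b \<le> rk v" using \<open>(a, b) \<in> B\<close> max [of a b] by (simp add: B_def)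
      ultimately show "(c, d) \<in> B" by (intro early) auto
    qed (use B_sub in auto)
    have "edge_monom (u, v) + t \<in> multiples (edge_monom ` B)
        \<longleftrightarrow> t \<in> multiples ((\<lambda>v. Poly_Mapping.single v 1) ` V)" for t
    proof -
      have keys: "w \<in> Poly_Mapping.keys (edge_monom (u, v) + t) \<longleftrightarrow> w = u \<or> w = v \<or> w \<in> Poly_Mapping.keys t" for w
        by (auto simp: in_keys_iff lookup_add edge_monom_def lookup_single when_def)
      have V: "w \<in> V" if "(a, b) \<in> B" "{a, b} = {w, u} \<or> {a, b} = {w, v}" "w \<noteq> u" "w \<noteq> v" for a b w
        using that unfolding V_def by blast
      have "edge_monom (u, v) + t \<in> multiples (edge_monom ` B) \<longleftrightarrow>
        (\<exists>(a, b)\<in>B. a \<in> Poly_Mapping.keys (edge_monom (u, v) + t) \<and> b \<in> Poly_Mapping.keys (edge_monom (u, v) + t))"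
        using B_sub by (intro in_multiples_edges) auto
      also have "\<dots> \<longleftrightarrow> (\<exists>w\<in>V. w \<in> Poly_Mapping.keys t)"
        unfolding keys
      proof
        assume "\<exists>w\<in>V. w \<in> Poly_Mapping.keys t"
        then obtain w a b where "w \<in> Poly_Mapping.keys t" "(a, b) \<in> B" "{a, b} = {w, u} \<or> {a, b} = {w, v}"
          unfolding V_def by blast
        then show "\<exists>(a, b)\<in>B. (a = u \<or> a = v \<or> a \<in> Poly_Mapping.keys t) \<and> (b = u \<or> b = v \<or> b \<in> Poly_Mapping.keys t)"
          by (intro bexI [of _ "(a, b)"]) (auto simp: doubleton_eq_iff)
      next
        assume "\<exists>(a, b)\<in>B. (a = u \<or> a = v \<or> a \<in> Poly_Mapping.keys t) \<and> (b = u \<or> b = v \<or> b \<in> Poly_Mapping.keys t)"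
        then obtain a b where ab: "(a, b) \<in> B" "a = u \<or> a = v \<or> a \<in> Poly_Mapping.keys t"
          "b = u \<or> b = v \<or> b \<in> Poly_Mapping.keys t" by blast
        have Eab: "E a b" "rk a < rk b" "rk b \<le> rk v" using ab(1) B_sub max [of a b] by (auto simp: B_def)
        show "\<exists>w\<in>V. w \<in> Poly_Mapping.keys t"
        proof (cases "a \<in> {u, v} \<or> b \<in> {u, v}")
          case True
          then consider "a \<in> {u, v}" "b \<notin> {u, v}" | "b \<in> {u, v}" "a \<notin> {u, v}"
            using ab(1) \<open>(u, v) \<notin> B\<close> Eab Euv
            by (cases "a = u"; cases "a = v"; cases "b = u"; cases "b = v") auto
          then show ?thesis
          proof cases
            case 1
            then have "b \<in> V" using ab(1) by (intro V [of a b]) auto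
            then show ?thesis using 1 ab(3) by auto
          next
            case 2
            then have "a \<in> V" using ab(1) by (intro V [of a b]) auto
            then show ?thesis using 2 ab(2) by auto
          qed
        next
          case False
          then obtain c where c: "c \<in> {a, b}" "c \<in> X" using cover [OF Eab(1)] by auto
          \<comment> \<open>Both \<open>a\<close> and \<open>b\<close> precede \<open>v\<close>,
            hence so does \<open>c\<close>; the edge joining \<open>u\<close> and \<open>c\<close>
            then has its larger end before \<open>v\<close> and already belongs to
            \<open>B\<close>.\<close>
          have "rk b \<noteq> rk v" using False inj by (auto dest: injD)
          then have "rk c < rk v" using c(1) Eab by auto
          \<comment> \<open>An edge meets \<open>X\<close>, and \<open>X\<close> is ranked first, so
            the smaller end always lies in \<open>X\<close>.\<close>
          have "u \<in> X" using cover [OF Euv(1)] X_first [of v u] Euv(2) by auto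
          have "u \<noteq> c" "v \<noteq> c" using False c(1) by auto
          have "E u c" "E c u" using clique \<open>u \<in> X\<close> c(2) \<open>u \<noteq> c\<close> by auto
          moreover have "rk u \<noteq> rk c" using \<open>u \<noteq> c\<close> inj by (auto dest: injD)
          ultimately have "(u, c) \<in> B \<or> (c, u) \<in> B"
            using early \<open>rk c < rk v\<close> Euv(2) by (cases "rk u < rk c") auto
          then have "c \<in> V" using V [of u c c] V [of c u c] \<open>u \<noteq> c\<close> \<open>v \<noteq> c\<close> by auto
          then show ?thesis using False ab c(1) by auto
        qed
      qed
      finally show ?thesis by (simp only: multiples_vars)
    qed
    moreover have "monom_deg (edge_monom (u, v)) = 2" by (simp add: edge_monom_def)
    ultimately have "linear_presentation 2 (monom_ideal (insert (edge_monom (u, v)) (edge_monom ` B)) :: ('v, 'k) mpoly set)"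
      by (rule linear_presentation_insert [OF IH linear_presentation_vars [OF finite]])
    then show ?case by (simp only: A_eq image_insert)
  qed
qed

theorem split_graph_linear_resolution:
  fixes E :: "'v::finite \<Rightarrow> 'v \<Rightarrow> bool"
  assumes "simple_graph E" "split_graph E"
  shows "has_linear_resolution (edge_ideal E :: ('v, 'k::field) mpoly set)"
proof -
  from assms(2) obtain X where X: "\<And>a b. a \<in> X \<Longrightarrow> b \<in> X \<Longrightarrow> a \<noteq> b \<Longrightarrow> E a b"
    "\<And>a b. E a b \<Longrightarrow> a \<in> X \<or> b \<in> X" unfolding split_graph_def by blast
  have sym: "\<And>a b. E a b \<Longrightarrow> E b a" and irr: "\<And>a. \<not> E a a"
    using assms(1) by (auto simp: simple_graph_def)
  obtain n and f :: "'v \<Rightarrow> nat" where f: "f ` UNIV = {i. i < n}" "inj f"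
    using finite_imp_inj_to_nat_seg [of "UNIV :: 'v set"] by auto
  have fn: "f a < n" for a using f(1) by blast
  define rk where "rk a = (if a \<in> X then f a else n + f a)" for a
  have inj: "inj rk"
  proof (rule injI)
    fix a b assume "rk a = rk b"
    then have "f a = f b" using fn [of a] fn [of b] by (auto simp: rk_def split: if_splits)
    then show "a = b" using f(2) by (simp add: inj_eq)
  qed
  have first: "a \<in> X" if "b \<in> X" "rk a < rk b" for a b
    using that fn [of b] by (auto simp: rk_def split: if_splits)
  let ?A = "{(a, b). E a b \<and> rk a < rk b}"
  have "edge_monom ` {(u, v). E u v} = edge_monom ` ?A"
  proof (intro equalityI subsetI)
    fix m assume "m \<in> edge_monom ` {(u, v). E u v}"
    then obtain u v where uv: "E u v" "m = edge_monom (u, v)" by blast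
    then have "u \<noteq> v" using irr by auto
    then consider "rk u < rk v" | "rk v < rk u" using inj [THEN injD, of u v] by fastforce
    then show "m \<in> edge_monom ` ?A"
    proof cases
      case 1
      then show ?thesis using uv by (intro image_eqI [of _ _ "(u, v)"]) auto
    next
      case 2
      then show ?thesis using uv sym by (intro image_eqI [of _ _ "(v, u)"]) (auto simp: edge_monom_commute)
    qed
  qed auto
  moreover have "linear_presentation 2 (monom_ideal (edge_monom ` ?A) :: ('v, 'k) mpoly set)"
    by (rule split_graph_linear_presentation [where E = E and X = X and rk = rk, OF X(1) X(2) inj first])
      auto
  ultimately show ?thesis
    by (simp add: edge_ideal_eq_monom_ideal linear_presentation_imp_linear_resolution)
qed

subsection \<open>A linear resolution excludes induced pairs of disjoint edges\<close>

text \<open>Let \<open>{a, b}\<close>, \<open>{c, d}\<close> be such a pair and \<open>F j\<close> the coefficient of \<open>x_a x_b\<close> in the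
  \<open>j\<close>-th generator \<open>f j\<close>. No other edge divides \<open>x_a x_b x_c\<close> or \<open>x_a x_b x_d\<close>, so for a linear syzygy
  \<open>s\<close> the form \<open>\<Sum>j. F j * s j\<close> contains neither \<open>x_c\<close> nor \<open>x_d\<close>; hence for every combination of
  linear syzygies its coefficient at \<open>x_c x_d\<close> vanishes. It equals 1 for the Koszul syzygy of
  \<open>x_a x_b\<close> and \<open>x_c x_d\<close>.\<close>
theorem linear_resolution_gap_free:
  fixes E :: "'v::finite \<Rightarrow> 'v \<Rightarrow> bool"
  assumes graph: "simple_graph E"
    and lin: "has_linear_resolution (edge_ideal E :: ('v, 'k::field) mpoly set)"
    and ab: "E a b" and cd: "E c d"
    and disj: "a \<noteq> c" "a \<noteq> d" "b \<noteq> c" "b \<noteq> d"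
    and gap: "\<not> E a c" "\<not> E a d" "\<not> E b c" "\<not> E b d"
  shows False
proof -
  let ?x = "\<lambda>v. Poly_Mapping.single v (1::nat)"
  let ?m = "\<lambda>u v. Poly_Mapping.single (edge_monom (u, v)) (1::'k)"
  have irr: "\<And>v. \<not> E v v" and sym: "\<And>u v. E u v \<Longrightarrow> E v u" using graph by (auto simp: simple_graph_def)
  have "a \<noteq> b" "c \<noteq> d" using ab cd irr by auto
  let ?I = "edge_ideal E :: ('v, 'k) mpoly set"
  from lin obtain p r and D :: "nat \<Rightarrow> nat \<Rightarrow> nat \<Rightarrow> ('v, 'k) mpoly" where
    *: "r 0 = 1 \<and> (\<forall>i\<le>p. \<forall>a b. homogeneous (if i = 0 then 2 else 1) (D i a b)) \<and>
      {(mat_apply (r 0) (r 1) (D 0) w) 0 | w. w \<in> free_vecs (r 1)} = ?I \<and>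
      (\<forall>i<p. {w \<in> free_vecs (r (i + 1)). mat_apply (r i) (r (i + 1)) (D i) w = (\<lambda>_. 0)}
             = mat_apply (r (i + 1)) (r (i + 2)) (D (i + 1)) ` free_vecs (r (i + 2))) \<and>
      {w \<in> free_vecs (r (p + 1)). mat_apply (r p) (r (p + 1)) (D p) w = (\<lambda>_. 0)} = {\<lambda>_. 0}"
    unfolding has_linear_resolution_def by (elim exE)
  define n where "n = r 1"
  define f where "f = D 0 0"
  note r0 = * [THEN conjunct1]
    and hom = * [THEN conjunct2, THEN conjunct1, rule_format]
    and img0 = * [THEN conjunct2, THEN conjunct2, THEN conjunct1]
    and exact = * [THEN conjunct2, THEN conjunct2, THEN conjunct2, THEN conjunct1, rule_format]
    and inj = * [THEN conjunct2, THEN conjunct2, THEN conjunct2, THEN conjunct2]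
  have f: "homogeneous 2 (f j)" for j using hom [of 0] by (simp add: f_def)
  have "kernel 1 n (\<lambda>_. f) = kernel (r 0) (r 1) (D 0)"
    by (auto simp: kernel_def mat_apply_def r0 n_def f_def fun_eq_iff)
  then have ker: "kernel 1 n (\<lambda>_. f) = {w \<in> free_vecs (r 1). mat_apply (r 0) (r 1) (D 0) w = (\<lambda>_. 0)}"
    by (simp only: kernel_def)
  have img: "{(\<Sum>j<n. f j * w j) | w. w \<in> free_vecs n} = ?I"
    using img0 by (simp add: mat_apply_def r0 n_def f_def)
  \<comment> \<open>If p = 0, the augmentation is injective and the matrix without columns spans its
    zero kernel.\<close>
  obtain n' S where S: "linear_matrix S" "kernel 1 n (\<lambda>_. f) = mat_apply n n' S ` free_vecs n'"
  proof (cases p)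
    case 0
    then have "kernel 1 n (\<lambda>_. f) = mat_apply n 0 (\<lambda>_ _. 0) ` free_vecs 0"
      using inj ker by (simp add: free_vecs_0)
    then show ?thesis using that [of "\<lambda>_ _. 0" 0] by simp
  next
    case (Suc q)
    then have "{w \<in> free_vecs (r 1). mat_apply (r 0) (r 1) (D 0) w = (\<lambda>_. 0)}
        = mat_apply (r 1) (r 2) (D 1) ` free_vecs (r 2)" using exact [of 0] by (simp add: numeral_2_eq_2)
    moreover have "linear_matrix (D 1)" using hom [of 1] Suc by simp
    ultimately show ?thesis using that [of "D 1" "r 2"] ker by (simp add: n_def)
  qed
  have row: "(\<Sum>j<n. f j * w j) = 0" if "w \<in> kernel 1 n (\<lambda>_. f)" for w
    using that by (simp add: kernel_row_iff del: One_nat_def)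
  define F where "F j = Poly_Mapping.lookup (f j) (edge_monom (a, b))" for j
  have fI: "f j \<in> ?I" if "j < n" for j
  proof -
    have "(\<Sum>i<n. f i * (if i = j then 1 else 0)) = (\<Sum>i<n. if i = j then f i else 0)"
      by (rule sum.cong) auto
    then have "f j = (\<Sum>i<n. f i * (if i = j then 1 else 0))" using that by simp
    moreover have "(\<lambda>i. if i = j then 1 else 0) \<in> free_vecs n" using that by (simp add: free_vecs_def)
    ultimately show ?thesis unfolding img [symmetric] by (intro CollectI exI conjI)
  qed
  \<comment> \<open>Each term of an element of the ideal is divisible by an edge; a product of two
    distinct variables is so only if it is that edge.\<close>
  have no_edge: "Poly_Mapping.lookup (f j) (edge_monom (u, v)) = 0" if "j < n" "u \<noteq> v" "\<not> E u v" for j u v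
  proof (rule ccontr)
    assume "Poly_Mapping.lookup (f j) (edge_monom (u, v)) \<noteq> 0"
    then have "edge_monom (u, v) \<in> multiples (edge_monom ` {(u, v). E u v})"
      using fI [OF that(1)] by (auto simp: edge_ideal_eq_monom_ideal monom_ideal_def in_keys_iff)
    then have "\<exists>(y, z)\<in>{(u, v). E u v}. y \<in> Poly_Mapping.keys (edge_monom (u, v)) \<and> z \<in> Poly_Mapping.keys (edge_monom (u, v))"
      using irr by (subst (asm) in_multiples_edges) auto
    then show False using that irr sym
      by (auto simp: in_keys_iff edge_monom_def lookup_add lookup_single when_def split: if_splits)
  qed
  have triple: "Poly_Mapping.lookup (f j * s) (edge_monom (a, b) + ?x e) = F j * Poly_Mapping.lookup s (?x e)"
    if "j < n" "e \<noteq> a" "e \<noteq> b" "\<not> E a e" "\<not> E b e" "homogeneous 1 s" for j s e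
  proof -
    have keys: "Poly_Mapping.keys (edge_monom (a, b) + ?x e) = {a, b, e}"
      by (auto simp: in_keys_iff edge_monom_def lookup_add lookup_single when_def split: if_splits)
    have "edge_monom (a, b) + ?x e - ?x a = edge_monom (b, e)"
      "edge_monom (a, b) + ?x e - ?x b = edge_monom (a, e)"
      "edge_monom (a, b) + ?x e - ?x e = edge_monom (a, b)"
      by (auto intro!: poly_mapping_eqI simp: edge_monom_def lookup_add lookup_minus)
    then show ?thesis using that \<open>a \<noteq> b\<close> no_edge [OF that(1), of a e] no_edge [OF that(1), of b e]
      by (subst mult.commute) (simp add: lookup_linear_mult keys F_def mult.commute del: One_nat_def)
  qed
  have S0: "(\<Sum>j<n. F j * Poly_Mapping.lookup (S j l) (?x e)) = 0"
    if "l < n'" "e \<noteq> a" "e \<noteq> b" "\<not> E a e" "\<not> E b e" for l e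
  proof -
    have "(\<lambda>i. if i = l then 1 else 0) \<in> free_vecs n'" using that by (simp add: free_vecs_def)
    then have "(\<lambda>i. if i < n then S i l else 0) \<in> kernel 1 n (\<lambda>_. f)"
      unfolding S(2) mat_apply_unit [OF that(1), symmetric] by (rule imageI)
    then have "(\<Sum>j<n. f j * S j l) = 0" using row by fastforce
    then have "Poly_Mapping.lookup (\<Sum>j<n. f j * S j l) (edge_monom (a, b) + ?x e) = 0" by simp
    then show ?thesis using that S(1) by (simp add: lookup_sum triple del: One_nat_def)
  qed
  \<comment> \<open>In \<open>S j l * z l\<close> the monomial x_c x_d takes one variable from the
    linear form and the other from \<open>z l\<close>. After exchanging the sums, \<open>S0\<close>
    annihilates each inner sum over \<open>j\<close>.\<close>
  have S_cd: "(\<Sum>j<n. F j * Poly_Mapping.lookup (mat_apply n n' S z j) (edge_monom (c, d))) = 0" for z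
  proof -
    have keys: "Poly_Mapping.keys (edge_monom (c, d)) = {c, d}"
      by (auto simp: in_keys_iff edge_monom_def lookup_add lookup_single when_def split: if_splits)
    have "edge_monom (c, d) - ?x c = ?x d" "edge_monom (c, d) - ?x d = ?x c"
      by (auto intro!: poly_mapping_eqI simp: edge_monom_def lookup_add lookup_minus)
    then have "F j * Poly_Mapping.lookup (mat_apply n n' S z j) (edge_monom (c, d))
      = (\<Sum>l<n'. F j * Poly_Mapping.lookup (S j l) (?x c) * Poly_Mapping.lookup (z l) (?x d)
          + F j * Poly_Mapping.lookup (S j l) (?x d) * Poly_Mapping.lookup (z l) (?x c))" if "j < n" for j
      using that S(1) \<open>c \<noteq> d\<close>
      by (simp add: mat_apply_def lookup_sum lookup_linear_mult keys sum_distrib_left distrib_left mult.assoc del: One_nat_def)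
    then have "(\<Sum>j<n. F j * Poly_Mapping.lookup (mat_apply n n' S z j) (edge_monom (c, d)))
      = (\<Sum>j<n. \<Sum>l<n'. F j * Poly_Mapping.lookup (S j l) (?x c) * Poly_Mapping.lookup (z l) (?x d)
          + F j * Poly_Mapping.lookup (S j l) (?x d) * Poly_Mapping.lookup (z l) (?x c))"
      by (intro sum.cong) simp_all
    also have "\<dots> = (\<Sum>l<n'. (\<Sum>j<n. F j * Poly_Mapping.lookup (S j l) (?x c)) * Poly_Mapping.lookup (z l) (?x d)
          + (\<Sum>j<n. F j * Poly_Mapping.lookup (S j l) (?x d)) * Poly_Mapping.lookup (z l) (?x c))"
      by (subst sum.swap) (simp add: sum.distrib sum_distrib_right)
    also have "\<dots> = 0" using S0 disj gap by (simp del: One_nat_def)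
    finally show ?thesis .
  qed
  have "?m u v \<in> ?I" if "E u v" for u v
    unfolding edge_ideal_eq_monom_ideal using that by (intro monom_ideal_single) auto
  then have ex: "\<exists>w. w \<in> free_vecs n \<and> ?m u v = (\<Sum>j<n. f j * w j)" if "E u v" for u v
    using that unfolding img [symmetric] by blast
  obtain w where w: "w \<in> free_vecs n" "?m a b = (\<Sum>j<n. f j * w j)" using ex [OF ab] by blast
  obtain z where z: "z \<in> free_vecs n" "?m c d = (\<Sum>j<n. f j * z j)" using ex [OF cd] by blast
  \<comment> \<open>The Koszul syzygy written in the generators \<open>f\<close>, with
    \<open>w\<close> and \<open>z\<close> the coordinates of x_a x_b and x_c x_d.\<close>
  let ?k = "\<lambda>j. ?m c d * w j - ?m a b * z j"
  have "(\<Sum>j<n. f j * ?k j) = ?m c d * (\<Sum>j<n. f j * w j) - ?m a b * (\<Sum>j<n. f j * z j)"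
    by (simp add: sum_subtractf sum_distrib_left algebra_simps)
  also have "\<dots> = 0" unfolding w(2) [symmetric] z(2) [symmetric] by simp
  finally have "?k \<in> kernel 1 n (\<lambda>_. f)"
    using w(1) z(1) by (simp add: kernel_row_iff free_vecs_def del: One_nat_def)
  then obtain y where y: "?k = mat_apply n n' S y" unfolding S(2) by blast
  \<comment> \<open>As x_a x_b does not divide x_c x_d, the second summand contributes nothing, and
    the first leaves the constant term of \<open>w j\<close>.\<close>
  have k: "Poly_Mapping.lookup (?k j) (edge_monom (c, d)) = Poly_Mapping.lookup (w j) 0" for j
  proof -
    have "edge_monom (c, d) \<noteq> edge_monom (a, b) + t" for t
    proof
      assume "edge_monom (c, d) = edge_monom (a, b) + t"
      then have "Poly_Mapping.lookup (edge_monom (c, d)) a = Poly_Mapping.lookup (edge_monom (a, b) + t) a" by simp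
      then show False using disj by (simp add: edge_monom_def lookup_add lookup_single)
    qed
    then show ?thesis using lookup_single_mult [of "edge_monom (c, d)" 1 "w j" 0]
      by (simp add: lookup_minus lookup_single_mult_not_dvd)
  qed
  \<comment> \<open>\<open>f j\<close> is a quadric, so only the constant term of \<open>w j\<close>
    takes part in degree 2.\<close>
  have const: "Poly_Mapping.lookup (f j * w j) (edge_monom (a, b)) = F j * Poly_Mapping.lookup (w j) 0" for j
  proof -
    have deg: "monom_deg (edge_monom (a, b)) = 2" by (simp add: edge_monom_def)
    have h0: "hpart 0 (w j) = Poly_Mapping.single 0 (Poly_Mapping.lookup (w j) 0)"
      by (rule poly_mapping_eqI) (auto simp: lookup_hpart lookup_single when_def monom_deg_eq_0_iff)
    have "Poly_Mapping.lookup (f j * w j) (edge_monom (a, b))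
        = Poly_Mapping.lookup (hpart (2 + 0) (f j * w j)) (edge_monom (a, b))"
      by (simp add: lookup_hpart deg)
    also have "\<dots> = Poly_Mapping.lookup (Poly_Mapping.single 0 (Poly_Mapping.lookup (w j) 0) * f j) (0 + edge_monom (a, b))"
      unfolding hpart_mult_homogeneous [OF f] h0 by (simp add: mult.commute)
    also have "\<dots> = F j * Poly_Mapping.lookup (w j) 0"
      unfolding lookup_single_mult by (simp add: F_def)
    finally show ?thesis .
  qed
  have "1 = Poly_Mapping.lookup (?m a b) (edge_monom (a, b))" by simp
  also have "\<dots> = (\<Sum>j<n. F j * Poly_Mapping.lookup (w j) 0)"
    unfolding w(2) by (simp add: lookup_sum const)
  also have "\<dots> = (\<Sum>j<n. F j * Poly_Mapping.lookup (mat_apply n n' S y j) (edge_monom (c, d)))"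
    unfolding y [symmetric] k ..
  also have "\<dots> = 0" by (rule S_cd)
  finally show False by simp
qed

subsection \<open>Squares of paths, stars and whiskered stars are split graphs\<close>

lemma simple_graph_square: "simple_graph E \<Longrightarrow> simple_graph (graph_square E)"
  unfolding simple_graph_def graph_square_def by blast

lemma split_square_path:
  assumes "is_path_graph E n" "n \<le> 5"
  shows "split_graph (graph_square E)"
proof -
  from assms(1) obtain f where f: "bij_betw f {..<n} UNIV"
    and E: "\<And>i j. i < n \<Longrightarrow> j < n \<Longrightarrow> E (f i) (f j) \<longleftrightarrow> i + 1 = j \<or> j + 1 = i"
    unfolding is_path_graph_def by blast
  have surj: "\<exists>i<n. a = f i" for a using f by (auto simp: bij_betw_def image_iff)
  \<comment> \<open>Counting from 0, the vertices 1, 2, 3 are pairwise within distance 2. Left over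
    are 0 and, for n = 5, also 4, at distance 4 from each other.\<close>
  let ?X = "f ` {i. i < n \<and> 1 \<le> i \<and> i \<le> 3}"
  have "graph_square E a b" if "a \<in> ?X" "b \<in> ?X" "a \<noteq> b" for a b
  proof -
    from that obtain i j where ij: "i < n" "j < n" "1 \<le> i" "1 \<le> j" "i \<le> 3" "j \<le> 3" "i \<noteq> j" "a = f i" "b = f j"
      by auto
    have "E (f i) (f j) \<or> (E (f i) (f 2) \<and> E (f 2) (f j))"
      using ij by (auto simp: E)
    then show ?thesis using that(3) ij by (auto simp: graph_square_def)
  qed
  moreover have "a \<in> ?X \<or> b \<in> ?X" if "graph_square E a b" for a b
  proof (rule ccontr)
    assume *: "\<not> (a \<in> ?X \<or> b \<in> ?X)"
    obtain i j where ij: "i < n" "j < n" "a = f i" "b = f j" using surj by blast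
    with * have "i = 0 \<or> i = 4" "j = 0 \<or> j = 4" using assms(2) by force+
    moreover have "i \<noteq> j" using that ij by (auto simp: graph_square_def)
    ultimately have "i = 0 \<and> j = 4 \<or> i = 4 \<and> j = 0" by auto
    moreover from that consider "E a b" | z where "E a z" "E z b" by (auto simp: graph_square_def)
    then have "E (f i) (f j) \<or> (\<exists>k<n. E (f i) (f k) \<and> E (f k) (f j))"
    proof cases
      case 2
      obtain k where "k < n" "z = f k" using surj by blast
      with 2 ij show ?thesis by blast
    qed (simp add: ij)
    ultimately show False using ij by (auto simp: E)
  qed
  ultimately show ?thesis unfolding split_graph_def by blast
qed

text \<open>Any two leaves share the centre, so the square is complete.\<close>

lemma split_square_star:
  assumes "is_star_graph E"
  shows "split_graph (graph_square E)"
proof -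
  from assms obtain c where "\<And>a b. E a b \<longleftrightarrow> ((a = c \<and> b \<noteq> c) \<or> (b = c \<and> a \<noteq> c))"
    unfolding is_star_graph_def by blast
  then have "graph_square E a b" if "a \<noteq> b" for a b
    using that by (cases "a = c \<or> b = c") (auto simp: graph_square_def)
  then show ?thesis unfolding split_graph_def by blast
qed

text \<open>The centre and its neighbours form a clique of the square. Each \<open>y i\<close> has
  \<open>x i\<close> as its only neighbour, so any two of these leaves are at distance 4.\<close>

lemma split_square_whiskered_star:
  assumes "is_whiskered_star E"
  shows "split_graph (graph_square E)"
proof -
  from assms [unfolded is_whiskered_star_def] obtain n m :: nat and x y where
    *: "1 \<le> n \<and> 1 \<le> m \<and> m \<le> n \<and> inj_on x {0..n} \<and> inj_on y {1..m} \<and>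
      x ` {0..n} \<inter> y ` {1..m} = {} \<and> x ` {0..n} \<union> y ` {1..m} = UNIV \<and>
      (\<forall>a b. E a b \<longleftrightarrow> ((\<exists>i\<in>{1..n}. {a, b} = {x 0, x i}) \<or> (\<exists>i\<in>{1..m}. {a, b} = {x i, y i})))"
    by (elim exE)
  then have mn: "m \<le> n" and x: "inj_on x {0..n}" and y: "inj_on y {1..m}"
    and disj: "x ` {0..n} \<inter> y ` {1..m} = {}" and univ: "x ` {0..n} \<union> y ` {1..m} = UNIV"
    by - (elim conjE, assumption)+
  have E: "E a b \<longleftrightarrow> (\<exists>i\<in>{1..n}. {a, b} = {x 0, x i}) \<or> (\<exists>i\<in>{1..m}. {a, b} = {x i, y i})" for a b
    using * by (elim conjE) (simp only:)
  let ?X = "x ` {0..n}"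
  have centre: "E (x 0) (x i)" "E (x i) (x 0)" if "i \<in> {1..n}" for i
    using that unfolding E by blast+
  have "graph_square E a b" if "a \<in> ?X" "b \<in> ?X" "a \<noteq> b" for a b
  proof -
    from that obtain i j where ij: "i \<le> n" "j \<le> n" "a = x i" "b = x j" by auto
    show ?thesis
      using that(3) centre [of i] centre [of j] ij unfolding graph_square_def
      by (cases "i = 0"; cases "j = 0") auto
  qed
  moreover have "a \<in> ?X \<or> b \<in> ?X" if sq: "graph_square E a b" for a b
  proof (rule ccontr)
    assume "\<not> (a \<in> ?X \<or> b \<in> ?X)"
    then have aX: "a \<notin> ?X" and bX: "b \<notin> ?X" by auto
    then obtain i j where ij: "i \<in> {1..m}" "j \<in> {1..m}" "a = y i" "b = y j" using univ by blast
    have nbr: "z = x k" if Ez: "E (y k) z" and k: "k \<in> {1..m}" for k z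
    proof -
      have "y k \<notin> ?X" using disj k by blast
      then have "\<not> (\<exists>i\<in>{1..n}. {y k, z} = {x 0, x i})" by (auto simp: doubleton_eq_iff)
      then obtain l where l: "l \<in> {1..m}" "{y k, z} = {x l, y l}" using Ez unfolding E by blast
      have "x l \<in> ?X" using l(1) mn by auto
      then have "y k = y l" "z = x l" using l(2) \<open>y k \<notin> ?X\<close> by (auto simp: doubleton_eq_iff)
      then show ?thesis using y k l(1) by (auto dest: inj_onD)
    qed
    have sym: "E u v \<longleftrightarrow> E v u" for u v unfolding E by (simp add: insert_commute)
    have "\<not> E a b" using nbr [of i b] ij bX mn by auto
    then obtain z where "E a z" "E z b" using sq unfolding graph_square_def by blast
    then have "x i = x j" using nbr [of i z] nbr [of j z] ij sym by auto
    then have "i = j" using x ij mn by (auto dest: inj_onD)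
    then show False using that ij by (simp add: graph_square_def)
  qed
  ultimately show ?thesis unfolding split_graph_def by blast
qed

subsection \<open>Trees with gap-free square\<close>

text \<open>Walks that never turn straight back. In a tree they are paths, so an unwanted edge is
  excluded by a walk of this kind that meets a vertex twice.\<close>

fun nonbacktracking :: "('v \<Rightarrow> 'v \<Rightarrow> bool) \<Rightarrow> 'v list \<Rightarrow> bool" where
  "nonbacktracking E (a # b # c # vs) \<longleftrightarrow> E a b \<and> a \<noteq> c \<and> nonbacktracking E (b # c # vs)"
| "nonbacktracking E [a, b] \<longleftrightarrow> E a b"
| "nonbacktracking E _ \<longleftrightarrow> True"

lemma nonbacktracking_nth: "nonbacktracking E vs \<Longrightarrow> i + 1 < length vs \<Longrightarrow> E (vs ! i) (vs ! (i + 1))"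
  by (induction E vs arbitrary: i rule: nonbacktracking.induct) (auto simp: nth_Cons split: nat.splits)

lemma nonbacktracking_ConsD: "nonbacktracking E (v # vs) \<Longrightarrow> nonbacktracking E vs"
  by (cases vs; cases "tl vs") auto

locale tree =
  fixes E :: "'v \<Rightarrow> 'v \<Rightarrow> bool"
  assumes tree: "is_tree E"
begin

lemma simple: "simple_graph E"
  using tree by (simp add: is_tree_def)

lemma sym: "E a b \<Longrightarrow> E b a" and irrefl: "\<not> E a a"
  using simple by (auto simp: simple_graph_def)

text \<open>If the first vertex reappears, the stretch from its successor to the reappearance is a
  cycle: it has at least 3 vertices because there are no loops and no turns, and they are distinct
  by induction.\<close>

lemma nonbacktracking_distinct: "nonbacktracking E vs \<Longrightarrow> distinct vs"
proof (induction vs)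
  case (Cons v vs)
  have nb: "nonbacktracking E vs" using Cons.prems by (rule nonbacktracking_ConsD)
  then have dist: "distinct vs" by (rule Cons.IH)
  have "v \<notin> set vs"
  proof
    assume "v \<in> set vs"
    then obtain i where i: "i < length vs" "vs ! i = v" by (auto simp: in_set_conv_nth)
    then obtain w ws where vs: "vs = w # ws" by (cases vs) auto
    have "E v w" using Cons.prems vs by (cases ws) auto
    have "i \<noteq> 0"
    proof
      assume "i = 0"
      then have "v = w" using i vs by simp
      then show False using \<open>E v w\<close> irrefl by simp
    qed
    moreover have "i \<noteq> 1" using i Cons.prems vs by (cases ws) auto
    ultimately have "i \<ge> 2" by linarith
    let ?c = "take (Suc i) vs"
    have "length ?c = Suc i" using i by simp
    moreover have "distinct ?c" using dist by simp
    moreover have "\<forall>j. j + 1 < length ?c \<longrightarrow> E (?c ! j) (?c ! (j + 1))"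
      using nonbacktracking_nth [OF nb] by simp
    moreover have "last ?c = v" using i by (simp add: take_Suc_conv_app_nth)
    moreover have "hd ?c = w" using vs by simp
    ultimately have "has_cycle E" unfolding has_cycle_def using \<open>i \<ge> 2\<close> \<open>E v w\<close>
      by (intro exI [of _ ?c]) auto
    then show False using tree by (simp add: is_tree_def)
  qed
  with dist show ?case by simp
qed simp

text \<open>An edge or a common neighbour \<open>v\<close> of the ends would close the walk. If
  \<open>v\<close> is next to an end on the walk itself, that end is cut off first. Each case leaves
  a nonbacktracking walk with a repeated vertex; the longer versions argue alike.\<close>

lemma not_square_4:
  assumes "nonbacktracking E [a, b, c, d]"
  shows "a \<noteq> d \<and> \<not> graph_square E a d"
proof -
  have dist: "distinct [a, b, c, d]" using assms by (rule nonbacktracking_distinct)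
  have "\<not> E a d"
    using assms dist nonbacktracking_distinct [of "[d, a, b, c, d]"] sym [of a d] by auto
  moreover have "\<not> (E a v \<and> E v d)" for v
    using assms dist nonbacktracking_distinct [of "[b, c, d, b]"]
      nonbacktracking_distinct [of "[a, b, c, a]"]
      nonbacktracking_distinct [of "[v, a, b, c, d, v]"] sym [of a v] sym [of v d] sym [of b d] sym [of a c]
    by (cases "v = b"; cases "v = c") auto
  ultimately show ?thesis using dist by (auto simp: graph_square_def)
qed

lemma not_square_5:
  assumes "nonbacktracking E [a, b, c, d, e]"
  shows "a \<noteq> e \<and> \<not> graph_square E a e"
proof -
  have dist: "distinct [a, b, c, d, e]" using assms by (rule nonbacktracking_distinct)
  have "\<not> E a e"
    using assms dist nonbacktracking_distinct [of "[e, a, b, c, d, e]"] sym [of a e] by auto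
  moreover have "\<not> (E a v \<and> E v e)" for v
    using assms dist nonbacktracking_distinct [of "[b, c, d, e, b]"]
      nonbacktracking_distinct [of "[a, b, c, d, a]"]
      nonbacktracking_distinct [of "[v, a, b, c, d, e, v]"] sym [of a v] sym [of v e] sym [of b e] sym [of a d]
    by (cases "v = b"; cases "v = d") auto
  ultimately show ?thesis using dist by (auto simp: graph_square_def)
qed

lemma not_square_6:
  assumes "nonbacktracking E [a, b, c, d, e, f]"
  shows "a \<noteq> f \<and> \<not> graph_square E a f"
proof -
  have dist: "distinct [a, b, c, d, e, f]" using assms by (rule nonbacktracking_distinct)
  have "\<not> E a f"
    using assms dist nonbacktracking_distinct [of "[f, a, b, c, d, e, f]"] sym [of a f] by auto
  moreover have "\<not> (E a v \<and> E v f)" for v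
    using assms dist nonbacktracking_distinct [of "[b, c, d, e, f, b]"]
      nonbacktracking_distinct [of "[a, b, c, d, e, a]"]
      nonbacktracking_distinct [of "[v, a, b, c, d, e, f, v]"] sym [of a v] sym [of v f] sym [of b f] sym [of a e]
    by (cases "v = b"; cases "v = e") auto
  ultimately show ?thesis using dist by (auto simp: graph_square_def)
qed

end

section \<open>Gaps in the square of a tree\<close>

definition gap_free :: "('v \<Rightarrow> 'v \<Rightarrow> bool) \<Rightarrow> bool" where
  "gap_free G \<longleftrightarrow> (\<forall>a b c d. G a b \<and> G c d \<and> a \<noteq> c \<and> a \<noteq> d \<and> b \<noteq> c \<and> b \<noteq> d \<longrightarrow>
    G a c \<or> G a d \<or> G b c \<or> G b d)"

lemma gap_freeD:
  assumes "gap_free G" "G a b" "G c d"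
    "a \<noteq> c \<and> \<not> G a c" "a \<noteq> d \<and> \<not> G a d" "b \<noteq> c \<and> \<not> G b c" "b \<noteq> d \<and> \<not> G b d"
  shows False
  using assms unfolding gap_free_def by blast

locale gap_free_tree = tree +
  assumes gap_free: "gap_free (graph_square E)"
begin

lemma square_edge: "E a b \<Longrightarrow> graph_square E a b"
  using irrefl by (auto simp: graph_square_def)

lemma square_siblings: "E a b \<Longrightarrow> E a c \<Longrightarrow> b \<noteq> c \<Longrightarrow> graph_square E b c"
  using sym by (auto simp: graph_square_def)

text \<open>The two end edges form a gap: even their closest ends, \<open>b\<close> and
  \<open>e\<close>, are at distance 3.\<close>

lemma no_path_6: "\<not> nonbacktracking E [a, b, c, d, e, f]"
proof
  assume nb: "nonbacktracking E [a, b, c, d, e, f]"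
  show False
    by (rule gap_freeD [OF gap_free, of a b e f])
      (use nb in \<open>simp_all add: square_edge not_square_4 [of b c d e] not_square_5 [of a b c d e]
        not_square_5 [of b c d e f] not_square_6 [of a b c d e f]\<close>)
qed

text \<open>Two such neighbours of \<open>x\<close> would be adjacent in the square and at distances
  3 and 4 from \<open>w\<close> and \<open>z\<close>.\<close>

lemma single_leg:
  assumes "nonbacktracking E [y, x, c, w, z]" "E x y'" "y' \<noteq> c"
  shows "y' = y"
proof (rule ccontr)
  assume "y' \<noteq> y"
  have nb: "nonbacktracking E [y', x, c, w, z]" using assms sym [of x y'] by simp
  show False
    by (rule gap_freeD [OF gap_free, of y y' w z])
      (use assms nb sym [of y x] \<open>y' \<noteq> y\<close> in \<open>simp_all add: square_edge square_siblings [of x]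
        not_square_4 [of y x c w] not_square_4 [of y' x c w] not_square_5 [of y x c w z] not_square_5 [of y' x c w z]\<close>)
qed

text \<open>The siblings \<open>u\<close>, \<open>u'\<close> and the siblings \<open>v\<close>,
  \<open>v'\<close> are edges of the square, with all four distances between them equal to
  3.\<close>

lemma no_double_star:
  assumes "E a b" "E a u" "E a u'" "u \<noteq> u'" "u \<noteq> b" "u' \<noteq> b"
    and "E b v" "E b v'" "v \<noteq> v'" "v \<noteq> a" "v' \<noteq> a"
  shows False
  by (rule gap_freeD [OF gap_free, of u u' v v'])
    (use assms sym [of a u] sym [of a u'] in \<open>simp_all add: square_siblings [of a] square_siblings [of b]
      not_square_4 [of u a b v] not_square_4 [of u a b v'] not_square_4 [of u' a b v] not_square_4 [of u' a b v']\<close>)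

text \<open>The centre is read off a longest path: the middle of one on 5 vertices, an inner vertex
  of one on 4, the middle of one on 3. The two properties bound the depth seen from it by 2 and the
  legs at each of its neighbours by one.\<close>

lemma obtain_centre:
  obtains c where "\<And>u v w. \<not> nonbacktracking E [c, u, v, w]"
    and "\<And>u y y'. E c u \<Longrightarrow> E u y \<Longrightarrow> E u y' \<Longrightarrow> y \<noteq> c \<Longrightarrow> y' \<noteq> c \<Longrightarrow> y = y'"
proof -
  note centre = that
  consider (path5) v1 v2 c v4 v5 where "nonbacktracking E [v1, v2, c, v4, v5]"
    | (path4) a1 a b b1 where "\<And>v1 v2 v3 v4 v5. \<not> nonbacktracking E [v1, v2, v3, v4, v5]"
        "nonbacktracking E [a1, a, b, b1]"
    | (star) "\<And>v1 v2 v3 v4. \<not> nonbacktracking E [v1, v2, v3, v4]"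
    by blast
  then show ?thesis
  proof cases
    case path5
    then have path: "E v1 v2" "E v2 c" "E c v4" "E v4 v5" "v1 \<noteq> c" "v2 \<noteq> v4" "c \<noteq> v5" by simp_all
    have rev: "E v5 v4" "E v4 c" "E c v2" "E v2 v1" using path sym by blast+
    show ?thesis
    proof (rule centre [of c])
      \<comment> \<open>One half of the path avoids \<open>u\<close>. A walk of three steps through
        \<open>u\<close> prolongs it to 6 vertices; a walk of two steps prolongs it to 5, where
        \<open>single_leg\<close> applies.\<close>
      fix u v w show "\<not> nonbacktracking E [c, u, v, w]"
        using path rev no_path_6 [of v1 v2 c u v w] no_path_6 [of v5 v4 c u v w]
        by (cases "u = v2") auto
    next
      fix u y y' assume u: "E c u" "E u y" "E u y'" "y \<noteq> c" "y' \<noteq> c"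
      then have "E y u" "E u c" using sym by blast+
      then show "y = y'"
        using u path rev single_leg [of y u c v4 v5 y'] single_leg [of y u c v2 v1 y']
        by (cases "u = v2") auto
    qed
  next
    case path4
    \<comment> \<open>When \<open>a\<close> does not branch, \<open>b\<close> is the centre: a leg
      beyond any other neighbour of \<open>b\<close> would give a path on 5 vertices.\<close>
    have main: ?thesis if nb: "nonbacktracking E [a1, a, b, b1]"
      and only: "\<And>u. E a u \<Longrightarrow> u \<noteq> b \<Longrightarrow> u = a1" for a1 a b b1
    proof (rule centre [of b])
      have path: "E a1 a" "E a b" "E b b1" "a1 \<noteq> b" "a \<noteq> b1" using nb by simp_all
      then have rev: "E a a1" "E b a" "E b1 b" using sym by blast+
      fix u v w
      show "\<not> nonbacktracking E [b, u, v, w]"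
      proof
        assume *: "nonbacktracking E [b, u, v, w]"
        then have "E w v" "E v u" "E u b" using sym by auto
        then show False
          using * path rev only [of v] path4(1) [of w v u b a] path4(1) [of b1 b u v w]
          by (cases "u = a") auto
      qed
    next
      have path: "E a1 a" "E a b" "E b b1" "a1 \<noteq> b" "a \<noteq> b1" using nb by simp_all
      then have rev: "E a a1" "E b a" "E b1 b" using sym by blast+
      fix u y y' assume u: "E b u" "E u y" "E u y'" "y \<noteq> b" "y' \<noteq> b"
      then have "E y u" "E u b" using sym by blast+
      then show "y = y'"
        using u path rev only [of y] only [of y'] path4(1) [of y u b a a1]
        by (cases "u = a") auto
    qed
    have path: "E a1 a" "E a b" "E b b1" "a1 \<noteq> b" "a \<noteq> b1" using path4(2) by simp_all
    then have rev: "E a a1" "E b a" "E b1 b" using sym by blast+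
    show ?thesis
    proof (cases "\<exists>u. E a u \<and> u \<noteq> b \<and> u \<noteq> a1")
      case False
      then show ?thesis using main [OF path4(2)] by blast
    next
      case True
      then obtain u where u: "E a u" "u \<noteq> b" "u \<noteq> a1" by blast
      \<comment> \<open>Branching at \<open>a\<close> forbids branching at \<open>b\<close>, so the
        path read backwards fits \<open>main\<close>.\<close>
      have "v = b1" if "E b v" "v \<noteq> a" for v
        using no_double_star [of a b a1 u b1 v] u that path rev by auto
      moreover have "nonbacktracking E [b1, b, a, a1]" using path rev by simp
      ultimately show ?thesis using main by blast
    qed
  next
    case star
    \<comment> \<open>The middle of a path on 3 vertices works, since a walk of two steps from it
      would prolong to 4 vertices on one side; without such a path any vertex does.\<close>
    have "\<exists>c. \<forall>u v. \<not> nonbacktracking E [c, u, v]"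
    proof (cases "\<exists>u c v. nonbacktracking E [u, c, v]")
      case True
      then obtain u c v where *: "nonbacktracking E [u, c, v]" by blast
      then have "E c u" "E v c" using sym by auto
      then have "\<not> nonbacktracking E [c, x, y]" for x y
        using * star [of u c x y] star [of v c x y] by (cases "x = u") auto
      then show ?thesis by blast
    qed blast
    then obtain c where c: "\<And>u v. \<not> nonbacktracking E [c, u, v]" by blast
    show ?thesis
    proof (rule centre [of c])
      show "\<not> nonbacktracking E [c, u, v, w]" for u v w using star by blast
      show "y = y'" if "E c u" "E u y" "E u y'" "y \<noteq> c" "y' \<noteq> c" for u y y'
        using c [of u y] that by simp
    qed
  qed
qed

lemma star_or_whiskered_star:
  assumes "finite (UNIV :: 'a set)" "card (UNIV :: 'a set) \<ge> 2"
  shows "is_star_graph E \<or> is_whiskered_star E"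
proof -
  obtain c where c: "\<And>u v w. \<not> nonbacktracking E [c, u, v, w]"
    and leg: "\<And>u y y'. E c u \<Longrightarrow> E u y \<Longrightarrow> E u y' \<Longrightarrow> y \<noteq> c \<Longrightarrow> y' \<noteq> c \<Longrightarrow> y = y'"
    using obtain_centre by blast
  have reach: "v = c \<or> E c v \<or> (\<exists>u. E c u \<and> E u v)" for v
  proof -
    have "E\<^sup>*\<^sup>* c v" using tree by (simp add: is_tree_def connected_graph_def)
    then show ?thesis
    proof induction
      case (step v w)
      show ?case
      proof (cases "v = c \<or> E c v")
        case False
        then obtain u where "E c u" "E u v" using step.IH by blast
        then show ?thesis using c [of u v w] step.hyps(2) False by auto
      qed (use step.hyps in blast)
    qed simp
  qed
  have "\<exists>v. v \<noteq> c"
  proof (rule ccontr)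
    assume "\<not> (\<exists>v. v \<noteq> c)"
    then have "(UNIV :: 'a set) = {c}" by auto
    then have "card (UNIV :: 'a set) = 1" by (metis card_1_singleton_iff One_nat_def)
    then show False using assms(2) by simp
  qed
  define N where "N = {u. E c u}"
  \<comment> \<open>The neighbours of the centre that carry a whisker.\<close>
  define P where "P = {u \<in> N. \<exists>y. E u y \<and> y \<noteq> c}"
  \<comment> \<open>An edge inside \<open>N\<close> would close a triangle with \<open>c\<close>; an
    edge avoiding both \<open>c\<close> and \<open>N\<close> would give a walk of three steps from
    \<open>c\<close>.\<close>
  have edge_nbr: "a = c \<or> b = c \<or> (a \<in> P \<and> b \<notin> insert c N) \<or> (b \<in> P \<and> a \<notin> insert c N)" if ab: "E a b" for a b
  proof -
    have notN: "b \<notin> N" if "E a b" "a \<in> N" for a b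
      using that nonbacktracking_distinct [of "[c, a, b, c]"] irrefl sym [of c b] by (auto simp: N_def)
    have "a \<in> N \<or> b \<in> N" if ac: "a \<noteq> c" and bc: "b \<noteq> c"
    proof (rule ccontr)
      assume "\<not> (a \<in> N \<or> b \<in> N)"
      then obtain u where "E c u" "E u a" "u \<noteq> b" using reach [of a] ac by (auto simp: N_def)
      then show False using c [of u a b] ab ac bc by simp
    qed
    then show ?thesis using notN [of a b] notN [of b a] ab sym [OF ab] by (auto simp: P_def)
  qed
  show ?thesis
  proof (cases "P = {}")
    case True
    have "E a b \<longleftrightarrow> (a = c \<and> b \<noteq> c) \<or> (b = c \<and> a \<noteq> c)" for a b
    proof
      assume "E a b"
      then show "(a = c \<and> b \<noteq> c) \<or> (b = c \<and> a \<noteq> c)" using edge_nbr [of a b] True irrefl by auto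
    next
      have "E c v" if "v \<noteq> c" for v
        using reach [of v] that True by (auto simp: P_def N_def)
      then show "E a b" if "(a = c \<and> b \<noteq> c) \<or> (b = c \<and> a \<noteq> c)" using that sym by blast
    qed
    then show ?thesis using \<open>\<exists>v. v \<noteq> c\<close> unfolding is_star_graph_def by blast
  next
    case False
    have fin: "finite A" for A :: "'a set" using assms(1) by (rule finite_subset [rotated]) simp
    have "P \<subseteq> N" by (auto simp: P_def)
    define n m where "n = card N" and "m = card P"
    have "1 \<le> m" using False fin [of P] by (simp add: m_def Suc_le_eq card_gt_0_iff)
    have "m \<le> n" unfolding m_def n_def using fin \<open>P \<subseteq> N\<close> by (intro card_mono)
    obtain g where g: "bij_betw g {1..m} P"
      using finite_same_card_bij [of "{1..m}" P] fin by (auto simp: m_def)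
    have "card {m+1..n} = card (N - P)" using card_Diff_subset [OF fin \<open>P \<subseteq> N\<close>] by (simp add: m_def n_def)
    then obtain h where h: "bij_betw h {m+1..n} (N - P)"
      using finite_same_card_bij [of "{m+1..n}" "N - P"] fin by auto
    \<comment> \<open>\<open>P\<close> is numbered first, so that whisker \<open>i\<close> sits at
      \<open>x i\<close> for \<open>i\<close> up to \<open>m\<close>.\<close>
    define x where "x i = (if i = 0 then c else if i \<le> m then g i else h i)" for i
    have "bij_betw x {1..m} P" using g by (rule bij_betw_cong [THEN iffD1, rotated]) (auto simp: x_def)
    moreover have "bij_betw x {m+1..n} (N - P)" using h by (rule bij_betw_cong [THEN iffD1, rotated]) (auto simp: x_def)
    ultimately have "bij_betw x ({1..m} \<union> {m+1..n}) (P \<union> (N - P))" by (rule bij_betw_combine) auto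
    moreover have "{1..m} \<union> {m+1..n} = {1..n}" using \<open>m \<le> n\<close> by auto
    moreover have "P \<union> (N - P) = N" using \<open>P \<subseteq> N\<close> by auto
    ultimately have xN: "bij_betw x {1..n} N" by simp
    have xP: "x ` {1..m} = P" using \<open>bij_betw x {1..m} P\<close> by (simp add: bij_betw_def)
    have x0: "x 0 = c" by (simp add: x_def)
    have "c \<notin> N" using irrefl by (simp add: N_def)
    have set0: "{0..n} = insert 0 {1..n}" by auto
    have x_inj: "inj_on x {0..n}" and x_img: "x ` {0..n} = insert c N"
      using xN \<open>c \<notin> N\<close> x0 unfolding set0 by (auto simp: bij_betw_def)
    have "\<forall>i\<in>{1..m}. \<exists>z. E (x i) z \<and> z \<noteq> c" using xP by (auto simp: P_def)
    then obtain y where y: "\<And>i. i \<in> {1..m} \<Longrightarrow> E (x i) (y i) \<and> y i \<noteq> c" by metis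
    have xiP: "x i \<in> P" if "i \<in> {1..m}" for i using xP that by blast
    have xiN: "E c (x i)" if "i \<in> {1..n}" for i using xN that by (auto simp: bij_betw_def N_def)
    have y_far: "y i \<notin> insert c N" if "i \<in> {1..m}" for i
      using edge_nbr [of "x i" "y i"] y [OF that] xiP [OF that] \<open>P \<subseteq> N\<close> \<open>c \<notin> N\<close> by auto
    have y_inj: "inj_on y {1..m}"
    proof (rule inj_onI)
      fix i j assume ij: "i \<in> {1..m}" "j \<in> {1..m}" "y i = y j"
      \<comment> \<open>A vertex hanging on two neighbours of \<open>c\<close> would close a 4-cycle
        through \<open>c\<close>.\<close>
      have "x i = x j"
      proof (rule ccontr)
        assume "x i \<noteq> x j"
        then have "nonbacktracking E [c, x i, y i, x j, c]"
          using y [OF ij(1)] y [OF ij(2)] ij xiN [of i] xiN [of j] sym \<open>m \<le> n\<close> by auto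
        then show False using nonbacktracking_distinct by fastforce
      qed
      then show "i = j" using x_inj ij \<open>m \<le> n\<close> by (auto dest: inj_onD)
    qed
    have univ: "x ` {0..n} \<union> y ` {1..m} = UNIV"
    proof -
      have "v \<in> insert c N \<or> v \<in> y ` {1..m}" for v
      proof (cases "v \<in> insert c N")
        case False
        then obtain u where u: "E c u" "E u v" using reach [of v] by (auto simp: N_def)
        then have "u \<in> P" using False by (auto simp: P_def N_def)
        then obtain i where i: "i \<in> {1..m}" "u = x i" using xP by blast
        then have "v = y i" using leg [OF u(1) u(2)] y [OF i(1)] False by auto
        then show ?thesis using i by blast
      qed simp
      then show ?thesis unfolding x_img by blast
    qed
    have edges: "E a b \<longleftrightarrow> ((\<exists>i\<in>{1..n}. {a, b} = {x 0, x i}) \<or> (\<exists>i\<in>{1..m}. {a, b} = {x i, y i}))" for a b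
    proof
      have leg_edge: "\<exists>i\<in>{1..m}. {a, b} = {x i, y i}" if "E a b" and aP: "a \<in> P" and "b \<noteq> c" for a b
      proof -
        obtain i where i: "i \<in> {1..m}" "a = x i" using xP aP by blast
        have "E c a" using aP by (simp add: P_def N_def)
        then have "b = y i" using leg [of a b "y i"] y [OF i(1)] \<open>E a b\<close> \<open>b \<noteq> c\<close> i(2) by auto
        then show ?thesis using i by blast
      qed
      have ray: "\<exists>i\<in>{1..n}. b = x i" if "E c b" for b
        using xN that by (auto simp: bij_betw_def N_def)
      assume ab: "E a b"
      from edge_nbr [OF ab] consider "a = c" | "b = c" | "a \<in> P" "b \<noteq> c" | "b \<in> P" "a \<noteq> c" by auto
      then show "(\<exists>i\<in>{1..n}. {a, b} = {x 0, x i}) \<or> (\<exists>i\<in>{1..m}. {a, b} = {x i, y i})"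
      proof cases
        case 1
        then show ?thesis using ray [of b] ab x0 by auto
      next
        case 2
        then show ?thesis using ray [of a] sym [OF ab] x0 by auto
      next
        case 3
        then show ?thesis using leg_edge [OF ab] by blast
      next
        case 4
        then show ?thesis using leg_edge [OF sym [OF ab]] by (simp add: insert_commute)
      qed
    next
      assume "(\<exists>i\<in>{1..n}. {a, b} = {x 0, x i}) \<or> (\<exists>i\<in>{1..m}. {a, b} = {x i, y i})"
      then show "E a b" using xiN y sym by (auto simp: x0 doubleton_eq_iff)
    qed
    have "is_whiskered_star E"
      unfolding is_whiskered_star_def
    proof (rule exI [of _ n], rule exI [of _ m], rule exI [of _ x], rule exI [of _ y], intro conjI allI)
      show "1 \<le> n" using \<open>1 \<le> m\<close> \<open>m \<le> n\<close> by linarith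
      show "x ` {0..n} \<inter> y ` {1..m} = {}"
      proof (rule equals0I)
        fix v assume "v \<in> x ` {0..n} \<inter> y ` {1..m}"
        then obtain i where "i \<in> {1..m}" "y i \<in> insert c N" unfolding x_img by blast
        then show False using y_far by blast
      qed
    qed (fact \<open>1 \<le> m\<close> \<open>m \<le> n\<close> x_inj y_inj univ edges)+
    then show ?thesis ..
  qed
qed

end

theorem theorem3p11:
  fixes E :: "'v::finite \<Rightarrow> 'v \<Rightarrow> bool"
  assumes "is_tree E"
    and "card (UNIV :: 'v set) \<ge> 2"
  shows "has_linear_resolution (edge_ideal (graph_square E) :: ('v, 'k::field) mpoly set)
    \<longleftrightarrow> ((\<exists>n. 2 \<le> n \<and> n \<le> 5 \<and> is_path_graph E n) \<or> is_star_graph E \<or> is_whiskered_star E)"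
proof -
  have simple: "simple_graph (graph_square E)"
    using assms(1) by (simp add: is_tree_def simple_graph_square)
  show ?thesis
  proof
    assume lin: "has_linear_resolution (edge_ideal (graph_square E) :: ('v, 'k) mpoly set)"
    have "gap_free (graph_square E)"
      unfolding gap_free_def using linear_resolution_gap_free [OF simple lin] by blast
    then interpret gap_free_tree E
      using assms(1) by unfold_locales
    \<comment> \<open>L_2 and L_3 are stars, L_4 and L_5 are whiskered stars with n = 2 and m = 1,
      2; so paths are reached through the last two alternatives.\<close>
    show "(\<exists>n. 2 \<le> n \<and> n \<le> 5 \<and> is_path_graph E n) \<or> is_star_graph E \<or> is_whiskered_star E"
      using star_or_whiskered_star assms(2) by simp
  next
    assume "(\<exists>n. 2 \<le> n \<and> n \<le> 5 \<and> is_path_graph E n) \<or> is_star_graph E \<or> is_whiskered_star E"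
    then have "split_graph (graph_square E)"
      using split_square_path split_square_star split_square_whiskered_star by blast
    with simple show "has_linear_resolution (edge_ideal (graph_square E) :: ('v, 'k) mpoly set)"
      by (rule split_graph_linear_resolution)
  qed
qed

end
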